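(* Let $d\ge 1$ be an integer and $0<\alpha<2$. Suppose that $d-\alpha>0$ or that $d-\alpha$ is not an even integer. Define, for $x\in\mathbb{R}^d$, $$\Phi_{d,\alpha}(x)=(1+|x|^2)^{(\alpha-d)/2},\qquad \Phi_{d,-\alpha}(x)=(1+|x|^2)^{(-\alpha-d)/2},\qquad \mu_{d,\alpha}=\frac{2^{\alpha}\,\Gamma\left(\frac{d+\alpha}{2}\right)}{\Gamma\left(\frac{d-\alpha}{2}\right)}.$$ Then for every $x\in\mathbb{R}^d$, $$(-\Delta)^{\alpha/2}\Phi_{d,\alpha}(x)=\mu_{d,\alpha}\,\Phi_{d,-\alpha}(x).$$
   Context: $|x|$ is the Euclidean norm on $\mathbb{R}^d$ and $\Gamma$ is the gamma function. The integral fractional Laplacian is $$(-\Delta)^{\alpha/2}u(x)=c_{d,\alpha}\int_{\mathbb{R}^d}\frac{u(x)-u(y)}{|x-y|^{d+\alpha}}\,dy,\qquad c_{d,\alpha}=\frac{2^{\alpha}\,\Gamma\left(\frac{\alpha+d}{2}\right)}{\pi^{d/2}\,|\Gamma(-\alpha/2)|},$$ where, when $\alpha\ge 1$, the integral is understood in the sense of the Cauchy principal value (limit as $\delta\to0^+$ of the integral over $|x-y|>\delta$). *)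

theory Defs
  imports "HOL-Analysis.Analysis"
begin

definition frac_lap_const :: "nat \<Rightarrow> real \<Rightarrow> real" where
  "frac_lap_const d \<alpha> =
     2 powr \<alpha> * Gamma ((\<alpha> + real d) / 2) / (pi powr (real d / 2) * \<bar>Gamma (- \<alpha> / 2)\<bar>)"

text \<open>The value at \<open>y = x\<close> is \<open>0 / 0 = 0\<close>; it is irrelevant to the integrals below.\<close>

definition frac_lap_integrand ::
    "real \<Rightarrow> ('a::euclidean_space \<Rightarrow> real) \<Rightarrow> 'a \<Rightarrow> 'a \<Rightarrow> real" where
  "frac_lap_integrand \<alpha> u x y = (u x - u y) / norm (x - y) powr (real DIM('a) + \<alpha>)"

text \<open>
  The integral is an absolutely convergent Lebesgue integral for \<open>\<alpha> < 1\<close> and a Cauchy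
  principal value for \<open>\<alpha> \<ge> 1\<close>. Since Lebesgue integrals and limits are total operators, the
  value of \<open>frac_lap\<close> is meaningful only together with \<open>frac_lap_exists\<close>.
\<close>

definition frac_lap_exists ::
    "real \<Rightarrow> ('a::euclidean_space \<Rightarrow> real) \<Rightarrow> 'a \<Rightarrow> bool" where
  "frac_lap_exists \<alpha> u x \<longleftrightarrow>
     (if \<alpha> < 1 then integrable lborel (frac_lap_integrand \<alpha> u x)
      else (\<forall>\<delta>>0. set_integrable lborel {y. norm (x - y) > \<delta>} (frac_lap_integrand \<alpha> u x)) \<and>
           (\<exists>L. ((\<lambda>\<delta>. LINT y:{y. norm (x - y) > \<delta>}|lborel. frac_lap_integrand \<alpha> u x y)
                  \<longlongrightarrow> L) (at_right 0)))"

definition frac_lap ::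
    "real \<Rightarrow> ('a::euclidean_space \<Rightarrow> real) \<Rightarrow> 'a \<Rightarrow> real" where
  "frac_lap \<alpha> u x = frac_lap_const DIM('a) \<alpha> *
     (if \<alpha> < 1 then LINT y|lborel. frac_lap_integrand \<alpha> u x y
      else Lim (at_right 0)
             (\<lambda>\<delta>. LINT y:{y. norm (x - y) > \<delta>}|lborel. frac_lap_integrand \<alpha> u x y))"

definition Phi :: "real \<Rightarrow> 'a::euclidean_space \<Rightarrow> real" where
  "Phi \<alpha> x = (1 + (norm x)\<^sup>2) powr ((\<alpha> - real DIM('a)) / 2)"

definition mu :: "nat \<Rightarrow> real \<Rightarrow> real" where
  "mu d \<alpha> = 2 powr \<alpha> * Gamma ((real d + \<alpha>) / 2) / Gamma ((real d - \<alpha>) / 2)"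

end

theory Submission
  imports Defs
begin

text \<open>
  Write \<open>d\<close> for the dimension and \<open>\<beta> = (d + \<alpha>) / 2\<close>. Up to a constant factor, the quotient
  \<open>(\<Phi>(x) - \<Phi>(x + z)) / |z|^(d + \<alpha>)\<close> is the integral over \<open>t > 0\<close> of \<open>t^(\<beta> - 1)\<close> times the
  difference of the values of \<open>(1 + |y|^2 + t |z|^2)^(-d)\<close> at \<open>y = x\<close> and \<open>y = x + z\<close>. This
  holds also when \<open>\<alpha> > d = 1\<close>, where \<open>\<Phi>\<close> is unbounded.
  For fixed \<open>t\<close> this difference can be integrated over \<open>z\<close> by completing the square: with
  \<open>A = 1 + |x|^2\<close>, the result is a multiple of \<open>(A t)^(-d/2) - (1 + A t)^(-d/2)\<close>. So the remaining
  integral over \<open>t\<close> scales like \<open>A^(-\<beta>)\<close>, which is \<open>\<Phi>(x)\<close> with \<open>-\<alpha>\<close> in place of \<open>\<alpha>\<close>, and the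
  constants are Beta integrals. Averaging over \<open>z\<close> and \<open>-z\<close> turns the principal value into an
  absolutely convergent integral; Fubini's theorem then applies because the second difference is
  bounded by a multiple of \<open>(1 + t |z|^2)^(-d) (1 + t)^(-1)\<close>.
\<close>

section \<open>Beta integrals and integrals of powers of quadratics\<close>

text \<open>The substitution y = (r / c) p / (1 - p) maps (0, 1) bijectively onto the half-line and
  turns r + c y into r / (1 - p), which leaves Euler's integral for \<open>Beta a b\<close>.\<close>

lemma nn_integral_Beta_half_line:
  fixes a b r c :: real
  assumes "a > 0" "b > 0" "r > 0" "c > 0"
  shows "(\<integral>\<^sup>+y. ennreal (y powr (a - 1) * (r + c * y) powr (- (a + b))) * indicator {0<..} y \<partial>lborel)
    = ennreal (r powr (- b) * c powr (- a) * Beta a b)"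
proof -
  define f where "f y = y powr (a - 1) * (r + c * y) powr (- (a + b))" for y :: real
  define g where "g p = r / c * (p / (1 - p))" for p :: real
  define K where "K = r powr (- b) * c powr (- a)"
  have der: "(g has_field_derivative r / c / (1 - p)\<^sup>2) (at p within {0<..<1})" if "p \<in> {0<..<1}" for p
    unfolding g_def using that
    using \<open>c > 0\<close> by (auto intro!: derivative_eq_intros simp: divide_simps power2_eq_square) (auto simp: algebra_simps)
  have img: "g ` {0<..<1} = {0<..}"
  proof (intro equalityI subsetI)
    fix y :: real assume "y \<in> {0<..}"
    hence y: "y > 0" by simp
    have "r + c * y > 0" using y assms by (simp add: add_pos_pos)
    hence "g (c * y / (r + c * y)) = y" "c * y / (r + c * y) \<in> {0<..<1}"
      using y assms by (auto simp: g_def divide_simps)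
    thus "y \<in> g ` {0<..<1}" by (metis image_eqI)
  qed (use assms in \<open>auto simp: g_def\<close>)
  have inj: "inj_on g {0<..<1}"
    unfolding g_def inj_on_def using assms by (auto simp: divide_simps) (auto simp: algebra_simps)
  have eq: "\<bar>r / c / (1 - p)\<^sup>2\<bar> * f (g p) = K * (p powr (a - 1) * (1 - p) powr (b - 1))"
    if "p \<in> {0<..<1}" for p
  proof -
    have p: "p > 0" "1 - p > 0" using that by auto
    have "r + c * g p = r / (1 - p)" using p assms by (simp add: g_def divide_simps algebra_simps)
    hence "\<bar>r / c / (1 - p)\<^sup>2\<bar> * f (g p) = r / c / (1 - p) powr 2 * ((r / c * (p / (1 - p))) powr (a - 1) * (r / (1 - p)) powr (- (a + b)))"
      using p assms by (simp add: f_def g_def powr_numeral)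
    also have "\<dots> = K * (p powr (a - 1) * (1 - p) powr (b - 1))"
    proof -
      have "r / c / q powr 2 * ((r / c * (p / q)) powr (a - 1) * (r / q) powr (- (a + b)))
        = r powr (- b) * c powr (- a) * (p powr (a - 1) * q powr (b - 1))" if "q > 0" for q
      proof -
        \<comment> \<open>In logarithmic variables the identity between products of powers becomes a
          linear identity between exponents.\<close>
        define P Q R C where "P = ln p" and "Q = ln q" and "R = ln r" and "C = ln c"
        hence e: "p = exp P" "q = exp Q" "r = exp R" "c = exp C"
          using p assms that by simp_all
        have "r / c / q powr 2 = exp (R - C - 2 * Q)" "r / c * (p / q) = exp (R - C + P - Q)" "r / q = exp (R - Q)"
          by (simp_all add: e exp_add exp_diff powr_def)
        hence "r / c / q powr 2 * ((r / c * (p / q)) powr (a - 1) * (r / q) powr (- (a + b)))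
          = exp ((R - C - 2 * Q) + ((a - 1) * (R - C + P - Q) + (- (a + b)) * (R - Q)))"
          by (simp only: powr_def exp_not_eq_zero if_False ln_exp exp_add)
        also have "(R - C - 2 * Q) + ((a - 1) * (R - C + P - Q) + (- (a + b)) * (R - Q))
          = (- b) * R + (- a) * C + ((a - 1) * P + (b - 1) * Q)"
          by (simp add: algebra_simps)
        also have "exp \<dots> = r powr (- b) * c powr (- a) * (p powr (a - 1) * q powr (b - 1))"
          unfolding e by (simp only: powr_def exp_not_eq_zero if_False ln_exp exp_add)
        finally show ?thesis .
      qed
      thus ?thesis unfolding K_def using p by blast
    qed
    finally show ?thesis .
  qed
  have B: "((\<lambda>p. p powr (a - 1) * (1 - p) powr (b - 1)) has_integral Beta a b) {0<..<1}"
    using has_integral_Beta_real[of a b] assms by (simp add: has_integral_Icc_iff_Ioo)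
  hence B': "((\<lambda>p. \<bar>r / c / (1 - p)\<^sup>2\<bar> * f (g p)) has_integral (K * Beta a b)) {0<..<1}"
    by (subst has_integral_cong[OF eq]) (auto intro: has_integral_mult_right)
  hence "(\<lambda>p. \<bar>r / c / (1 - p)\<^sup>2\<bar> * f (g p)) absolutely_integrable_on {0<..<1} \<and>
     integral {0<..<1} (\<lambda>p. \<bar>r / c / (1 - p)\<^sup>2\<bar> * f (g p)) = K * Beta a b"
    by (auto intro!: nonnegative_absolutely_integrable_1 simp: f_def integral_unique has_integral_integrable)
  hence "f absolutely_integrable_on {0<..} \<and> integral {0<..} f = K * Beta a b"
    using has_absolute_integral_change_of_variables_1'[OF _ der inj, of f "K * Beta a b"] img by auto
  hence "(f has_integral (K * Beta a b)) {0<..}"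
    using set_lebesgue_integral_eq_integral(1) by (metis integrable_integral)
  from nn_integral_has_integral_lebesgue'[OF _ this]
  have "(\<integral>\<^sup>+y. ennreal (f y) * indicator {0<..} y \<partial>lborel) = ennreal (K * Beta a b)"
    by (simp add: f_def)
  thus ?thesis by (simp add: f_def K_def)
qed

lemma nn_integral_powr_interval:
  fixes A B e :: real
  assumes "0 \<le> A" "A \<le> B" "e \<noteq> 0" "0 < A \<or> 0 < e"
  shows "(\<integral>\<^sup>+c. ennreal (c powr (e - 1)) * indicator {A..B} c \<partial>lborel)
    = ennreal ((B powr e - A powr e) / e)"
proof -
  have "((\<lambda>c. c powr (e - 1)) has_integral (B powr e / e - A powr e / e)) {A..B}"
  \<comment> \<open>The interior version is used because A = 0 is allowed for positive e, and c^e
    need not be differentiable at 0.\<close>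
  proof (rule fundamental_theorem_of_calculus_interior)
    show "continuous_on {A..B} (\<lambda>c. c powr e / e)"
      using assms by (auto intro!: continuous_intros continuous_on_powr')
    fix c assume "c \<in> {A<..<B}"
    thus "((\<lambda>c. c powr e / e) has_vector_derivative c powr (e - 1)) (at c)"
      using assms unfolding has_real_derivative_iff_has_vector_derivative[symmetric]
      by (auto intro!: derivative_eq_intros)
  qed (use assms in auto)
  from nn_integral_has_integral_lebesgue'[OF _ this] show ?thesis
    by (simp add: diff_divide_distrib)
qed

lemma nn_integral_powr_shift:
  fixes A B s N :: real
  assumes "0 \<le> A" "A \<le> B" "s > 0" "N > 0"
  shows "(\<integral>\<^sup>+c. ennreal (N * (c + s) powr (- N - 1)) * indicator {A..B} c \<partial>lborel)
    = ennreal ((A + s) powr (- N) - (B + s) powr (- N))"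
proof -
  have "((\<lambda>c. N * (c + s) powr (- N - 1)) has_integral ((- ((B + s) powr (- N))) - (- ((A + s) powr (- N))))) {A..B}"
    using assms
    by (intro fundamental_theorem_of_calculus)
       (auto intro!: derivative_eq_intros simp: has_real_derivative_iff_has_vector_derivative[symmetric])
  from nn_integral_has_integral_lebesgue'[OF _ this] show ?thesis using assms by simp
qed

lemma Beta_real_nonneg: "a > 0 \<Longrightarrow> b > 0 \<Longrightarrow> Beta a b \<ge> (0 :: real)"
  by (simp add: Beta_def)

text \<open>The difference of powers is an integral over c in [A, B]. Integrating over t first gives
  a Beta integral proportional to c^(\<beta> - N - 1), and the integral of this power over [A, B] is
  the quotient on the right. For \<beta> > N the two terms taken separately diverge at infinity;
  only their difference converges.\<close>

lemma nn_integral_powr_difference: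
  fixes A B r N \<beta> :: real
  assumes AB: "0 \<le> A" "A \<le> B" "r > 0" "N > 0" "\<beta> > 0" "\<beta> < N + 1" "\<beta> \<noteq> N" "0 < A \<or> N < \<beta>"
  shows "(\<integral>\<^sup>+t. ennreal (t powr (\<beta> - 1) * ((A + r * t) powr (- N) - (B + r * t) powr (- N))) * indicator {0<..} t \<partial>lborel)
    = ennreal (N * Beta \<beta> (N + 1 - \<beta>) * r powr (- \<beta>) * ((B powr (\<beta> - N) - A powr (\<beta> - N)) / (\<beta> - N)))"
    (is "?L = ?R")
proof -
  let ?f = "\<lambda>t c. ennreal (t powr (\<beta> - 1) * (N * (c + r * t) powr (- N - 1))) * indicator {0<..} t * indicator {A..B} c"
  have "?L = (\<integral>\<^sup>+t. (\<integral>\<^sup>+c. ?f t c \<partial>lborel) \<partial>lborel)"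
  proof (rule nn_integral_cong)
    fix t :: real
    show "ennreal (t powr (\<beta> - 1) * ((A + r * t) powr (- N) - (B + r * t) powr (- N))) * indicator {0<..} t = (\<integral>\<^sup>+c. ?f t c \<partial>lborel)"
    proof (cases "t > 0")
      case True
      have "(\<integral>\<^sup>+c. ?f t c \<partial>lborel) = (\<integral>\<^sup>+c. ennreal (t powr (\<beta> - 1)) * (ennreal (N * (c + r * t) powr (- N - 1)) * indicator {A..B} c) \<partial>lborel)"
        using True AB by (intro nn_integral_cong) (simp add: ennreal_mult mult_ac)
      also have "\<dots> = ennreal (t powr (\<beta> - 1)) * ennreal ((A + r * t) powr (- N) - (B + r * t) powr (- N))"
        using nn_integral_powr_shift[of A B "r * t" N] AB True by (simp add: nn_integral_cmult)
      finally show ?thesis using True by (simp add: ennreal_mult')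
    qed simp
  qed
  also have "\<dots> = (\<integral>\<^sup>+c. (\<integral>\<^sup>+t. ?f t c \<partial>lborel) \<partial>lborel)"
    by (rule lborel_pair.Fubini') measurable
  also have "\<dots> = (\<integral>\<^sup>+c. ennreal (N * Beta \<beta> (N + 1 - \<beta>) * r powr (- \<beta>)) * (ennreal (c powr ((\<beta> - N) - 1)) * indicator {A..B} c) \<partial>lborel)"
  \<comment> \<open>If A = 0, the interval contains c = 0, where the Beta integral formula does not
    apply; a single point is a null set.\<close>
  proof (rule nn_integral_cong_AE, rule AE_mp[OF AE_lborel_singleton[of 0]], intro AE_I2 impI)
    fix c :: real assume "c \<noteq> 0"
    show "(\<integral>\<^sup>+t. ?f t c \<partial>lborel) = ennreal (N * Beta \<beta> (N + 1 - \<beta>) * r powr (- \<beta>)) * (ennreal (c powr ((\<beta> - N) - 1)) * indicator {A..B} c)"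
    proof (cases "c \<in> {A..B}")
      case True
      hence c: "c > 0" using \<open>c \<noteq> 0\<close> AB by auto
      have "(\<integral>\<^sup>+t. ?f t c \<partial>lborel) = (\<integral>\<^sup>+t. ennreal N * (ennreal (t powr (\<beta> - 1) * (c + r * t) powr (- (\<beta> + (N + 1 - \<beta>)))) * indicator {0<..} t) \<partial>lborel)"
        using True AB by (intro nn_integral_cong) (simp add: ennreal_mult mult_ac)
      also have "\<dots> = ennreal N * ennreal (c powr (- (N + 1 - \<beta>)) * r powr (- \<beta>) * Beta \<beta> (N + 1 - \<beta>))"
        using nn_integral_Beta_half_line[of \<beta> "N + 1 - \<beta>" c r] AB c by (simp add: nn_integral_cmult)
      also have "\<dots> = ennreal (N * Beta \<beta> (N + 1 - \<beta>) * r powr (- \<beta>)) * ennreal (c powr ((\<beta> - N) - 1))"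
      proof -
        have "Beta \<beta> (N + 1 - \<beta>) \<ge> 0"
          using AB by (intro Beta_real_nonneg) auto
        moreover have "- (N + 1 - \<beta>) = (\<beta> - N) - 1" by simp
        ultimately show ?thesis using AB by (simp only: ennreal_mult'[symmetric] mult_nonneg_nonneg powr_ge_zero less_imp_le) (simp add: mult_ac)
      qed
      finally show ?thesis using True by simp
    qed simp
  qed
  also have "\<dots> = ennreal (N * Beta \<beta> (N + 1 - \<beta>) * r powr (- \<beta>)) * ennreal ((B powr (\<beta> - N) - A powr (\<beta> - N)) / (\<beta> - N))"
    using nn_integral_powr_interval[of A B "\<beta> - N"] AB by (simp add: nn_integral_cmult)
  also have "\<dots> = ?R" using AB Beta_real_nonneg[of \<beta> "N + 1 - \<beta>"] by (subst ennreal_mult') auto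
  finally show ?thesis .
qed

text \<open>A layer-cake argument in place of polar coordinates: the power is the integral of D b (a
  + b y)^(-D-1) over y > |z - c|^2. After the exchange of integrals z runs through a ball of radius
  sqrt y, whose volume contributes y^(D/2), and a Beta integral in y remains.\<close>

lemma nn_integral_powr_norm:
  fixes a b :: real
  assumes "a > 0" "b > 0"
  defines "D \<equiv> real DIM('a::euclidean_space)"
  shows "(\<integral>\<^sup>+z. ennreal ((a + b * (norm (z - c :: 'a))\<^sup>2) powr (- D)) \<partial>lborel)
    = ennreal (D * unit_ball_vol D * Beta (D / 2 + 1) (D / 2) * (a * b) powr (- D / 2))"
proof -
  have D: "D > 0" by (simp add: D_def)
  let ?f = "\<lambda>z y. ennreal (D * b * (a + b * y) powr (- D - 1)) * indicator {y. (norm (z - c :: 'a))\<^sup>2 < y} y"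
  have 1: "(\<integral>\<^sup>+y. ?f z y \<partial>lborel) = ennreal ((a + b * (norm (z - c))\<^sup>2) powr (- D))" for z
  proof -
    define s where "s = (norm (z - c))\<^sup>2"
    have s: "s \<ge> 0" by (simp add: s_def)
    have "(\<integral>\<^sup>+y. ?f z y \<partial>lborel) = (\<integral>\<^sup>+y. ennreal (D * b * (a + b * y) powr (- D - 1)) * indicator {s..} y \<partial>lborel)"
      by (rule nn_integral_cong_AE, rule AE_mp[OF AE_lborel_singleton[of s]], rule AE_I2) (auto simp: s_def indicator_def)
    also have "\<dots> = ennreal (0 - (- ((a + b * s) powr (- D))))"
    proof (rule nn_integral_FTC_atLeast)
      show "((\<lambda>y. - ((a + b * y) powr (- D))) \<longlongrightarrow> 0) at_top"
      proof -
        have "filterlim (\<lambda>y. a + b * y) at_top at_top"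
          using filterlim_tendsto_add_at_top[OF tendsto_const filterlim_tendsto_pos_mult_at_top[OF tendsto_const \<open>b > 0\<close> filterlim_ident]] by simp
        hence "((\<lambda>y. (a + b * y) powr (- D)) \<longlongrightarrow> 0) at_top"
          using D tendsto_neg_powr[of "- D" "\<lambda>y. a + b * y" at_top] by simp
        from tendsto_minus[OF this] show ?thesis by simp
      qed
      fix y assume "s \<le> y"
      hence "a + b * y > 0" using s assms by (simp add: add_pos_nonneg)
      thus "((\<lambda>y. - ((a + b * y) powr (- D))) has_real_derivative D * b * (a + b * y) powr (- D - 1)) (at y)"
        by (auto intro!: derivative_eq_intros)
      show "0 \<le> D * b * (a + b * y) powr (- D - 1)" using D assms by simp
    qed auto
    finally show ?thesis by (simp add: s_def)
  qed
  have 2: "(\<integral>\<^sup>+z. ?f z y \<partial>lborel) = ennreal (D * unit_ball_vol D * b) * (ennreal (y powr (D / 2 + 1 - 1) * (a + b * y) powr (- (D / 2 + 1 + D / 2))) * indicator {0<..} y)" for y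
  proof (cases "y > 0")
    case True
    have "(norm (z - c))\<^sup>2 < y \<longleftrightarrow> z \<in> ball c (sqrt y)" for z :: 'a
      using True real_sqrt_less_iff[of "(norm (z - c))\<^sup>2" y] by (simp add: dist_norm norm_minus_commute)
    hence "(\<integral>\<^sup>+z. ?f z y \<partial>lborel) = (\<integral>\<^sup>+z. ennreal (D * b * (a + b * y) powr (- D - 1)) * indicator (ball c (sqrt y)) z \<partial>lborel)"
      by (intro nn_integral_cong) (auto simp: indicator_def)
    also have "\<dots> = ennreal (D * b * (a + b * y) powr (- D - 1)) * ennreal (unit_ball_vol D * sqrt y ^ DIM('a))"
      using True by (subst nn_integral_cmult_indicator) (auto simp: emeasure_ball D_def)
    also have "sqrt y ^ DIM('a) = y powr (D / 2)"
      using True by (simp add: powr_half_sqrt[symmetric] powr_powr D_def flip: powr_realpow)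
    also have "ennreal (D * b * (a + b * y) powr (- D - 1)) * ennreal (unit_ball_vol D * y powr (D / 2)) = 
      ennreal (D * unit_ball_vol D * b) * (ennreal (y powr (D / 2 + 1 - 1) * (a + b * y) powr (- (D / 2 + 1 + D / 2))) * indicator {0<..} y)"
    proof -
      have "- (D / 2 + 1 + D / 2) = - D - 1" by simp
      thus ?thesis using True D assms by (simp add: ennreal_mult[symmetric] mult_ac)
    qed
    finally show ?thesis .
  next
    case False
    hence "\<not> (norm (z - c))\<^sup>2 < y" for z using zero_le_power2[of "norm (z - c)"] by linarith
    thus ?thesis using False by simp
  qed
  have "(\<integral>\<^sup>+z. ennreal ((a + b * (norm (z - c))\<^sup>2) powr (- D)) \<partial>lborel) = (\<integral>\<^sup>+z. (\<integral>\<^sup>+y. ?f z y \<partial>lborel) \<partial>lborel)"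
    by (simp only: 1)
  also have "\<dots> = (\<integral>\<^sup>+y. (\<integral>\<^sup>+z. ?f z y \<partial>lborel) \<partial>lborel)"
    by (rule lborel_pair.Fubini') measurable
  also have "\<dots> = ennreal (D * unit_ball_vol D * b) * ennreal (a powr (- (D / 2)) * b powr (- (D / 2 + 1)) * Beta (D / 2 + 1) (D / 2))"
    unfolding 2 using nn_integral_Beta_half_line[of "D / 2 + 1" "D / 2" a b] D assms by (simp add: nn_integral_cmult)
  also have "\<dots> = ennreal (D * unit_ball_vol D * b * (a powr (- (D / 2)) * b powr (- (D / 2 + 1)) * Beta (D / 2 + 1) (D / 2)))"
    using D assms Beta_real_nonneg[of "D / 2 + 1" "D / 2"] by (intro ennreal_mult'[symmetric]) simp
  also have "D * unit_ball_vol D * b * (a powr (- (D / 2)) * b powr (- (D / 2 + 1)) * Beta (D / 2 + 1) (D / 2))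
    = D * unit_ball_vol D * Beta (D / 2 + 1) (D / 2) * (a * b) powr (- D / 2)"
  proof -
    have "b * b powr (- (D / 2 + 1)) = b powr (- D / 2)"
      using assms by (simp add: powr_mult_base)
    moreover have "(a * b) powr (- D / 2) = a powr (- (D / 2)) * b powr (- D / 2)"
      using assms by (simp add: powr_mult)
    moreover have "D * unit_ball_vol D * b * (a powr (- (D / 2)) * b powr (- (D / 2 + 1)) * Beta (D / 2 + 1) (D / 2))
      = D * unit_ball_vol D * Beta (D / 2 + 1) (D / 2) * (a powr (- (D / 2)) * (b * b powr (- (D / 2 + 1))))"
      by simp
    ultimately show ?thesis by simp
  qed
  finally show ?thesis .
qed

text \<open>Exchanging A and B changes the sign of both sides, so the ordered case, with its
  nonnegative integrand, suffices. The signed form is needed because |x + z| may lie on either side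
  of |x|.\<close>

lemma has_bochner_integral_powr_difference:
  fixes A B r N \<beta> :: real
  assumes "0 \<le> A" "0 \<le> B" "r > 0" "N > 0" "\<beta> > 0" "\<beta> < N + 1" "\<beta> \<noteq> N" "0 < A \<and> 0 < B \<or> N < \<beta>"
  shows "has_bochner_integral lborel
    (\<lambda>t. indicator {0<..} t * t powr (\<beta> - 1) * ((A + r * t) powr (- N) - (B + r * t) powr (- N)))
    (N * Beta \<beta> (N + 1 - \<beta>) / (N - \<beta>) * r powr (- \<beta>) * (A powr (\<beta> - N) - B powr (\<beta> - N)))"
proof -
  define f where "f A B t = indicator {0<..} t * t powr (\<beta> - 1) * ((A + r * t) powr (- N) - (B + r * t) powr (- N))" for A B t
  define V where "V A B = N * Beta \<beta> (N + 1 - \<beta>) / (N - \<beta>) * r powr (- \<beta>) * (A powr (\<beta> - N) - B powr (\<beta> - N))" for A B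
  have ord: "has_bochner_integral lborel (f A B) (V A B)"
    if "0 \<le> A" "A \<le> B" "0 < A \<or> N < \<beta>" for A B
  proof (rule has_bochner_integral_nn_integral)
    show "f A B \<in> borel_measurable lborel" unfolding f_def by measurable
    have nn: "f A B t \<ge> 0" for t
    proof (cases "t > 0")
      case True
      hence "(B + r * t) powr (- N) \<le> (A + r * t) powr (- N)"
        using that assms by (intro powr_mono2') (auto intro: add_nonneg_pos)
      thus ?thesis using True by (simp add: f_def)
    qed (simp add: f_def)
    thus "AE t in lborel. 0 \<le> f A B t" by simp
    have V: "V A B = N * Beta \<beta> (N + 1 - \<beta>) * r powr (- \<beta>) * ((B powr (\<beta> - N) - A powr (\<beta> - N)) / (\<beta> - N))"
      using \<open>\<beta> \<noteq> N\<close> by (simp add: V_def divide_simps) (simp add: algebra_simps)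
    have "(B powr (\<beta> - N) - A powr (\<beta> - N)) / (\<beta> - N) \<ge> 0"
    proof (cases "\<beta> > N")
      case True thus ?thesis using that by (auto intro!: divide_nonneg_nonneg powr_mono2)
    next
      case False
      thus ?thesis using that \<open>\<beta> \<noteq> N\<close> by (auto intro!: divide_nonpos_nonpos powr_mono2')
    qed
    thus "0 \<le> V A B" unfolding V using assms Beta_real_nonneg[of \<beta> "N + 1 - \<beta>"]
      by (intro mult_nonneg_nonneg) auto
    have "(\<integral>\<^sup>+t. ennreal (f A B t) \<partial>lborel) =
      (\<integral>\<^sup>+t. ennreal (t powr (\<beta> - 1) * ((A + r * t) powr (- N) - (B + r * t) powr (- N))) * indicator {0<..} t \<partial>lborel)"
      by (intro nn_integral_cong) (auto simp: f_def indicator_def)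
    also have "\<dots> = ennreal (V A B)"
      unfolding V using assms that by (intro nn_integral_powr_difference) auto
    finally show "(\<integral>\<^sup>+t. ennreal (f A B t) \<partial>lborel) = ennreal (V A B)" .
  qed
  have "has_bochner_integral lborel (f A B) (V A B)"
  proof (cases "A \<le> B")
    case True thus ?thesis using ord[of A B] assms by blast
  next
    case False
    hence "has_bochner_integral lborel (\<lambda>t. - f B A t) (- V B A)"
      using ord[of B A] assms by (intro has_bochner_integral_minus) auto
    moreover have "(\<lambda>t. - f B A t) = f A B" by (auto simp: f_def algebra_simps)
    moreover have "- V B A = V A B" unfolding V_def by (simp only: mult_minus_right[symmetric] minus_diff_eq)
    ultimately show ?thesis by simp
  qed
  thus ?thesis unfolding V_def f_def[abs_def] .
qed

lemma has_bochner_integral_powr_norm: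
  fixes a b :: real
  assumes "a > 0" "b > 0"
  defines "D \<equiv> real DIM('a::euclidean_space)"
  shows "has_bochner_integral lborel (\<lambda>z. (a + b * (norm (z - c :: 'a))\<^sup>2) powr (- D))
    (D * unit_ball_vol D * Beta (D / 2 + 1) (D / 2) * (a * b) powr (- D / 2))"
proof (rule has_bochner_integral_nn_integral)
  show "0 \<le> D * unit_ball_vol D * Beta (D / 2 + 1) (D / 2) * (a * b) powr (- D / 2)"
    using Beta_real_nonneg[of "D / 2 + 1" "D / 2"] by (simp add: D_def)
qed (use assms nn_integral_powr_norm[of a b c] in auto)

text \<open>Completing the square centres the quadratic at c = -x / (1 + t), with leading
  coefficient 1 + t and minimum a = 1 + |x|^2 t / (1 + t). The formula for a centred quadratic
  depends only on the product a (1 + t) = 1 + (1 + |x|^2) t.\<close>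

lemma has_bochner_integral_powr_norm_shift:
  fixes x :: "'a::euclidean_space"
  assumes "t > 0"
  defines "D \<equiv> real DIM('a)"
  shows "has_bochner_integral lborel (\<lambda>z. (1 + (norm (x + z))\<^sup>2 + t * (norm z)\<^sup>2) powr (- D))
    (D * unit_ball_vol D * Beta (D / 2 + 1) (D / 2) * (1 + (1 + (norm x)\<^sup>2) * t) powr (- D / 2))"
proof -
  define s where "s = 1 / (1 + t)"
  define c where "c = - s *\<^sub>R x"
  define a where "a = 1 + (norm x)\<^sup>2 * t / (1 + t)"
  have t: "1 + t > 0" using assms by simp
  have s: "(1 + t) * s = 1" using t by (simp add: s_def)
  have "(1 + t) * (norm (z - c))\<^sup>2 = (1 + t) * (norm z)\<^sup>2 + 2 * (x \<bullet> z) + (norm x)\<^sup>2 / (1 + t)" for z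
  proof -
    have "(norm (z - c))\<^sup>2 = (norm z)\<^sup>2 + s * (2 * (x \<bullet> z)) + s * (s * (norm x)\<^sup>2)"
      unfolding c_def power2_norm_eq_inner by (simp add: inner_add inner_commute algebra_simps)
    hence "(1 + t) * (norm (z - c))\<^sup>2 = (1 + t) * (norm z)\<^sup>2 + ((1 + t) * s) * (2 * (x \<bullet> z)) + ((1 + t) * s) * (s * (norm x)\<^sup>2)"
      by (simp only: distrib_left mult.assoc)
    thus ?thesis unfolding s by (simp add: s_def)
  qed
  moreover have "a + (norm x)\<^sup>2 / (1 + t) = 1 + (norm x)\<^sup>2"
    using t by (simp add: a_def divide_simps) (simp add: algebra_simps)
  ultimately have "a + (1 + t) * (norm (z - c))\<^sup>2 = 1 + (norm (x + z))\<^sup>2 + t * (norm z)\<^sup>2" for z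
  proof -
    fix z
    assume *: "\<And>z. (1 + t) * (norm (z - c))\<^sup>2 = (1 + t) * (norm z)\<^sup>2 + 2 * (x \<bullet> z) + (norm x)\<^sup>2 / (1 + t)"
      "a + (norm x)\<^sup>2 / (1 + t) = 1 + (norm x)\<^sup>2"
    have "(norm (x + z))\<^sup>2 = (norm x)\<^sup>2 + 2 * (x \<bullet> z) + (norm z)\<^sup>2"
      by (simp add: power2_norm_eq_inner inner_add inner_commute)
    thus "a + (1 + t) * (norm (z - c))\<^sup>2 = 1 + (norm (x + z))\<^sup>2 + t * (norm z)\<^sup>2"
      using *(2) unfolding *(1)[of z] by (simp add: distrib_right)
  qed
  moreover have "a * (1 + t) = 1 + (1 + (norm x)\<^sup>2) * t"
    using t by (simp add: a_def divide_simps) (simp add: algebra_simps)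
  moreover have "a > 0" using assms by (simp add: a_def add_pos_nonneg)
  ultimately show ?thesis
    using has_bochner_integral_powr_norm[of a "1 + t" c] t by (simp add: D_def)
qed

section \<open>Decay in t of first and second differences\<close>

lemma powr_diff_le:
  fixes a b m N :: real
  assumes "0 < m" "m \<le> a" "m \<le> b" "N > 0"
  shows "\<bar>a powr (- N) - b powr (- N)\<bar> \<le> N * m powr (- N - 1) * \<bar>a - b\<bar>"
proof -
  have "norm (a powr (- N) - b powr (- N)) \<le> N * m powr (- N - 1) * norm (a - b)"
  proof (rule field_differentiable_bound[where S = "{m..}" and f' = "\<lambda>c. (- N) * c powr (- N - 1)"])
    fix c assume c: "c \<in> {m..}"
    thus "((\<lambda>c. c powr (- N)) has_field_derivative (- N) * c powr (- N - 1)) (at c within {m..})"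
      using assms by (auto intro!: derivative_eq_intros)
    have "c powr (- N - 1) \<le> m powr (- N - 1)"
      using c assms by (intro powr_mono2') auto
    thus "norm ((- N) * c powr (- N - 1)) \<le> N * m powr (- N - 1)"
      using assms by (simp add: abs_mult)
  qed (use assms in auto)
  thus ?thesis by simp
qed

text \<open>The derivative of s -> (p + s)^(-N) + (p - s)^(-N) is, up to a factor, a first
  difference of powers with exponent -(N + 1). Two applications of the mean value inequality
  therefore give a bound quadratic in b.\<close>

lemma powr_second_diff_le:
  fixes p b m N :: real
  assumes "0 < m" "m \<le> p - \<bar>b\<bar>" "N > 0"
  shows "\<bar>2 * p powr (- N) - (p + b) powr (- N) - (p - b) powr (- N)\<bar> \<le> N * (N + 1) * m powr (- N - 2) * (2 * b\<^sup>2)"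
proof -
  let ?g = "\<lambda>s. (p + s) powr (- N) + (p - s) powr (- N)"
  have "norm (?g \<bar>b\<bar> - ?g 0) \<le> N * (N + 1) * m powr (- N - 2) * (2 * \<bar>b\<bar>) * norm (\<bar>b\<bar> - 0)"
  \<comment> \<open>The expression is even in b, so |b| may replace b; on [0, |b|] both p + s and p
    - s stay above m.\<close>
  proof (rule field_differentiable_bound[where S = "{0..\<bar>b\<bar>}" and f' = "\<lambda>s. (- N) * ((p + s) powr (- N - 1) - (p - s) powr (- N - 1))"])
    fix s assume s: "s \<in> {0..\<bar>b\<bar>}"
    thus "(?g has_field_derivative (- N) * ((p + s) powr (- N - 1) - (p - s) powr (- N - 1))) (at s within {0..\<bar>b\<bar>})"
      using assms by (auto intro!: derivative_eq_intros simp: algebra_simps)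
    have "\<bar>(p + s) powr (- (N + 1)) - (p - s) powr (- (N + 1))\<bar> \<le> (N + 1) * m powr (- (N + 1) - 1) * \<bar>(p + s) - (p - s)\<bar>"
      using s assms by (intro powr_diff_le) auto
    also have "\<dots> \<le> (N + 1) * m powr (- (N + 1) - 1) * (2 * \<bar>b\<bar>)"
      using s assms by (intro mult_left_mono) auto
    also have "- (N + 1) - 1 = - N - 2" by simp
    also have "- (N + 1) = - N - 1" by simp
    finally have F: "\<bar>(p + s) powr (- N - 1) - (p - s) powr (- N - 1)\<bar> \<le> (N + 1) * m powr (- N - 2) * (2 * \<bar>b\<bar>)" .
    show "norm ((- N) * ((p + s) powr (- N - 1) - (p - s) powr (- N - 1))) \<le> N * (N + 1) * m powr (- N - 2) * (2 * \<bar>b\<bar>)"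
      using mult_left_mono[OF F, of N] assms by (simp add: abs_mult mult.assoc)
  qed auto
  moreover have "\<bar>?g \<bar>b\<bar> - ?g 0\<bar> = \<bar>2 * p powr (- N) - (p + b) powr (- N) - (p - b) powr (- N)\<bar>"
    by (auto simp: abs_if)
  ultimately show ?thesis by (simp add: power2_eq_square mult_ac abs_mult)
qed

text \<open>Merges a bound for all t with a bound that gains t^(-\<gamma>) for t \<ge> 1. The factor
  2 comes from (1 + t)^\<gamma> \<le> 2 t^\<gamma> for t \<ge> 1 and (1 + t)^\<gamma> \<le> 2 for t
  < 1, both by \<gamma> \<le> 1.\<close>

lemma decay_bound:
  fixes t \<gamma> P C1 C2 e :: real
  assumes "t > 0" "0 \<le> \<gamma>" "\<gamma> \<le> 1" "\<bar>e\<bar> \<le> C1 * P" "t \<ge> 1 \<Longrightarrow> \<bar>e\<bar> * t powr \<gamma> \<le> C2 * P" "C1 \<ge> 0" "C2 \<ge> 0" "P \<ge> 0"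
  shows "\<bar>e\<bar> \<le> 2 * (C1 + C2) * P * (1 + t) powr (- \<gamma>)"
proof -
  have "\<bar>e\<bar> * (1 + t) powr \<gamma> \<le> 2 * ((C1 + C2) * P)"
  proof (cases "t \<ge> 1")
    case True
    have "(1 + t) powr \<gamma> \<le> (2 * t) powr \<gamma>"
      using True assms by (intro powr_mono2) auto
    also have "\<dots> = 2 powr \<gamma> * t powr \<gamma>" using True by (simp add: powr_mult)
    also have "\<dots> \<le> 2 * t powr \<gamma>" using powr_mono[of \<gamma> 1 2] assms by (intro mult_right_mono) auto
    finally have "\<bar>e\<bar> * (1 + t) powr \<gamma> \<le> \<bar>e\<bar> * (2 * t powr \<gamma>)" by (rule mult_left_mono) simp
    also have "\<dots> \<le> 2 * (C2 * P)" using assms True by simp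
    also have "\<dots> \<le> 2 * ((C1 + C2) * P)" using assms by (simp add: algebra_simps)
    finally show ?thesis .
  next
    case False
    have "(1 + t) powr \<gamma> \<le> 2 powr \<gamma>"
      using False assms by (intro powr_mono2) auto
    also have "\<dots> \<le> 2" using powr_mono[of \<gamma> 1 2] assms by auto
    finally have "\<bar>e\<bar> * (1 + t) powr \<gamma> \<le> \<bar>e\<bar> * 2" by (rule mult_left_mono) simp
    also have "\<dots> \<le> 2 * ((C1 + C2) * P)" using assms by (simp add: algebra_simps add_increasing2)
    finally show ?thesis .
  qed
  thus ?thesis using assms by (simp add: powr_minus divide_simps mult_ac)
qed

text \<open>The bases differ by |2 x.z + |z|^2|, and the mean value inequality supplies an extra
  factor 1 / a with a = 1 + t |z|^2. This factor absorbs t |z|^2 but only sqrt t times |z|, so the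
  linear term limits the rate to (1 + t)^(-1/2). Where |z| > \<delta>, the linear term is dominated
  by |z|^2 / \<delta>, and the rate improves to (1 + t)^(-1).\<close>

lemma first_difference_decay:
  fixes x z :: "'a::euclidean_space"
  assumes "t > 0" "N > 0"
  shows "\<bar>(1 + (norm x)\<^sup>2 + t * (norm z)\<^sup>2) powr (- N) - (1 + (norm (x + z))\<^sup>2 + t * (norm z)\<^sup>2) powr (- N)\<bar>
    \<le> 2 * (1 + N * (2 * norm x + 1)) * (1 + t * (norm z)\<^sup>2) powr (- N) * (1 + t) powr (- (1 / 2))" (is "\<bar>?e\<bar> \<le> _")
    and "\<delta> > 0 \<Longrightarrow> norm z > \<delta> \<Longrightarrow>
    \<bar>(1 + (norm x)\<^sup>2 + t * (norm z)\<^sup>2) powr (- N) - (1 + (norm (x + z))\<^sup>2 + t * (norm z)\<^sup>2) powr (- N)\<bar>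
    \<le> 2 * (1 + N * (2 * norm x / \<delta> + 1)) * (1 + t * (norm z)\<^sup>2) powr (- N) * (1 + t) powr (- 1)"
proof -
  define a where "a = 1 + t * (norm z)\<^sup>2"
  have a: "a \<ge> 1" "t * (norm z)\<^sup>2 \<le> a" using assms by (auto simp: a_def)
  have le: "a \<le> 1 + (norm x)\<^sup>2 + t * (norm z)\<^sup>2" "a \<le> 1 + (norm (x + z))\<^sup>2 + t * (norm z)\<^sup>2"
    by (simp_all add: a_def)
  have triv: "\<bar>?e\<bar> \<le> 1 * a powr (- N)"
  proof -
    have "(1 + (norm x)\<^sup>2 + t * (norm z)\<^sup>2) powr (- N) \<le> a powr (- N)"
      "(1 + (norm (x + z))\<^sup>2 + t * (norm z)\<^sup>2) powr (- N) \<le> a powr (- N)"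
      using a assms by (auto intro!: powr_mono2' le)
    thus ?thesis by (smt (verit) powr_ge_zero)
  qed
  have "\<bar>?e\<bar> \<le> N * a powr (- N - 1) * \<bar>(1 + (norm x)\<^sup>2 + t * (norm z)\<^sup>2) - (1 + (norm (x + z))\<^sup>2 + t * (norm z)\<^sup>2)\<bar>"
    using a le assms by (intro powr_diff_le) auto
  also have "\<dots> \<le> N * a powr (- N - 1) * (2 * norm x * norm z + (norm z)\<^sup>2)"
  proof (intro mult_left_mono)
    have "(1 + (norm x)\<^sup>2 + t * (norm z)\<^sup>2) - (1 + (norm (x + z))\<^sup>2 + t * (norm z)\<^sup>2) = - (2 * (x \<bullet> z) + (norm z)\<^sup>2)"
      by (simp add: power2_norm_eq_inner inner_add inner_commute)
    thus "\<bar>(1 + (norm x)\<^sup>2 + t * (norm z)\<^sup>2) - (1 + (norm (x + z))\<^sup>2 + t * (norm z)\<^sup>2)\<bar> \<le> 2 * norm x * norm z + (norm z)\<^sup>2"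
      using Cauchy_Schwarz_ineq2[of x z] abs_triangle_ineq[of "2 * (x \<bullet> z)" "(norm z)\<^sup>2"]
      by (simp only: abs_minus_cancel) (simp add: abs_mult)
  qed (use assms in auto)
  finally have b: "\<bar>?e\<bar> \<le> N * a powr (- N - 1) * (2 * norm x * norm z + (norm z)\<^sup>2)" .
  have pow: "a powr (- N - 1) * a = a powr (- N)" using a by (simp add: powr_mult_base mult.commute)
  \<comment> \<open>T stands for sqrt t in the first estimate and for t in the second; K is the
    constant with which a absorbs T.\<close>
  have step: "\<bar>?e\<bar> * T \<le> N * K * a powr (- N)"
    if "(2 * norm x * norm z + (norm z)\<^sup>2) * T \<le> K * a" "T \<ge> 0" for K T
  proof -
    have "\<bar>?e\<bar> * T \<le> N * a powr (- N - 1) * ((2 * norm x * norm z + (norm z)\<^sup>2) * T)"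
      using mult_right_mono[OF b that(2)] by (simp add: mult_ac)
    also have "\<dots> \<le> N * a powr (- N - 1) * (K * a)"
      using that assms by (intro mult_left_mono) auto
    also have "\<dots> = N * K * (a powr (- N - 1) * a)" by (simp add: mult_ac)
    finally show ?thesis unfolding pow .
  qed
  show "\<bar>?e\<bar> \<le> 2 * (1 + N * (2 * norm x + 1)) * (1 + t * (norm z)\<^sup>2) powr (- N) * (1 + t) powr (- (1 / 2))"
    unfolding a_def[symmetric]
  proof (rule decay_bound[OF _ _ _ triv])
    assume t: "t \<ge> 1"
    \<comment> \<open>This uses t |z|^2 \<le> a \<le> a^2, the last step because a \<ge> 1.\<close>
    have "norm z * sqrt t = sqrt (t * (norm z)\<^sup>2)" by (simp add: real_sqrt_mult)
    also have "\<dots> \<le> sqrt (a\<^sup>2)"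
      using a order_trans[OF a(2), of "a\<^sup>2"] by (intro real_sqrt_le_mono) (simp add: power2_eq_square)
    finally have 1: "norm z * sqrt t \<le> a" using a by simp
    have "sqrt t \<le> t" using t real_sqrt_le_mono[of t "t\<^sup>2"] by (simp add: power2_eq_square)
    hence "(norm z)\<^sup>2 * sqrt t \<le> (norm z)\<^sup>2 * t" by (intro mult_left_mono) auto
    hence 2: "(norm z)\<^sup>2 * sqrt t \<le> a" using a by (simp add: mult.commute)
    have "(2 * norm x * norm z + (norm z)\<^sup>2) * sqrt t = 2 * norm x * (norm z * sqrt t) + (norm z)\<^sup>2 * sqrt t"
      by (simp add: algebra_simps)
    also have "\<dots> \<le> 2 * norm x * a + a" using 1 2 by (intro add_mono mult_left_mono) auto
    finally show "\<bar>?e\<bar> * t powr (1 / 2) \<le> N * (2 * norm x + 1) * a powr (- N)"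
      using step[of "sqrt t" "2 * norm x + 1"] assms by (simp add: powr_half_sqrt algebra_simps)
  qed (use assms in auto)
  assume z: "\<delta> > 0" "norm z > \<delta>"
  show "\<bar>?e\<bar> \<le> 2 * (1 + N * (2 * norm x / \<delta> + 1)) * (1 + t * (norm z)\<^sup>2) powr (- N) * (1 + t) powr (- 1)"
    unfolding a_def[symmetric]
  proof (rule decay_bound[OF _ _ _ triv])
    have "\<delta> * norm z \<le> (norm z)\<^sup>2" using z by (simp add: power2_eq_square mult_right_mono)
    hence "norm z \<le> (norm z)\<^sup>2 / \<delta>" using z by (simp add: field_simps)
    hence "2 * norm x * norm z + (norm z)\<^sup>2 \<le> 2 * norm x * ((norm z)\<^sup>2 / \<delta>) + (norm z)\<^sup>2"
      by (intro add_mono mult_left_mono) auto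
    also have "\<dots> = (2 * norm x / \<delta> + 1) * (norm z)\<^sup>2" by (simp add: algebra_simps)
    finally have "(2 * norm x * norm z + (norm z)\<^sup>2) * t \<le> (2 * norm x / \<delta> + 1) * (norm z)\<^sup>2 * t"
      using assms by (intro mult_right_mono) auto
    also have "\<dots> = (2 * norm x / \<delta> + 1) * (t * (norm z)\<^sup>2)" by (simp add: mult_ac)
    also have "\<dots> \<le> (2 * norm x / \<delta> + 1) * a" using a z by (intro mult_left_mono) auto
    finally show "\<bar>?e\<bar> * t powr 1 \<le> N * (2 * norm x / \<delta> + 1) * a powr (- N)"
      using step[of t "2 * norm x / \<delta> + 1"] assms by simp
  qed (use assms z in auto)
qed

text \<open>With q = p + |z|^2 and b = 2 x.z the bases at x + z and x - z are q + b and q - b. The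
  expression splits into twice p^(-N) - q^(-N) and a symmetric second difference at q. The linear
  term has cancelled and both parts are of order |z|^2, so the rate (1 + t)^(-1) holds up to z =
  0.\<close>

lemma second_difference_decay:
  fixes x z :: "'a::euclidean_space"
  assumes "t > 0" "N > 0"
  shows "\<bar>2 * (1 + (norm x)\<^sup>2 + t * (norm z)\<^sup>2) powr (- N) - (1 + (norm (x + z))\<^sup>2 + t * (norm z)\<^sup>2) powr (- N)
      - (1 + (norm (x - z))\<^sup>2 + t * (norm z)\<^sup>2) powr (- N)\<bar>
    \<le> 2 * (2 + (2 * N + 8 * N * (N + 1) * (norm x)\<^sup>2)) * (1 + t * (norm z)\<^sup>2) powr (- N) * (1 + t) powr (- 1)" (is "\<bar>?e\<bar> \<le> _")
proof -
  define a where "a = 1 + t * (norm z)\<^sup>2"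
  define p where "p = 1 + (norm x)\<^sup>2 + t * (norm z)\<^sup>2"
  define q where "q = p + (norm z)\<^sup>2"
  define b where "b = 2 * (x \<bullet> z)"
  have plus: "1 + (norm (x + z))\<^sup>2 + t * (norm z)\<^sup>2 = q + b"
    and minus: "1 + (norm (x - z))\<^sup>2 + t * (norm z)\<^sup>2 = q - b"
    by (simp_all add: p_def q_def b_def power2_norm_eq_inner inner_add inner_diff inner_commute)
  have a: "a \<ge> 1" "t * (norm z)\<^sup>2 \<le> a" using assms by (auto simp: a_def)
  have le: "a \<le> p" "a \<le> q" "a \<le> q + b" "a \<le> q - b"
    unfolding plus[symmetric] minus[symmetric] by (simp_all add: a_def p_def q_def)
  have e: "?e = 2 * p powr (- N) - (q + b) powr (- N) - (q - b) powr (- N)"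
    by (simp add: plus minus flip: p_def)
  have triv: "\<bar>?e\<bar> \<le> 2 * a powr (- N)"
  proof -
    have "p powr (- N) \<le> a powr (- N)" "(q + b) powr (- N) \<le> a powr (- N)" "(q - b) powr (- N) \<le> a powr (- N)"
      using a le assms by (auto intro!: powr_mono2')
    thus ?thesis unfolding e by (smt (verit) powr_ge_zero)
  qed
  have "2 * \<bar>p powr (- N) - q powr (- N)\<bar> \<le> 2 * (N * a powr (- N - 1) * \<bar>p - q\<bar>)"
    using powr_diff_le[of a p q N] a le assms by auto
  hence 1: "2 * \<bar>p powr (- N) - q powr (- N)\<bar> \<le> 2 * N * a powr (- N - 1) * (norm z)\<^sup>2"
    by (simp add: q_def)
  have "\<bar>2 * q powr (- N) - (q + b) powr (- N) - (q - b) powr (- N)\<bar> \<le> N * (N + 1) * a powr (- N - 2) * (2 * b\<^sup>2)"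
    using a le assms by (intro powr_second_diff_le) auto
  also have "\<dots> \<le> N * (N + 1) * a powr (- N - 1) * (8 * ((norm x)\<^sup>2 * (norm z)\<^sup>2))"
  proof -
    \<comment> \<open>One of the two extra factors 1 / a is given up, so that both parts carry the
      same power of a.\<close>
    have "a powr (- N - 2) \<le> a powr (- N - 1)" using a by (intro powr_mono) auto
    moreover have "2 * b\<^sup>2 \<le> 8 * ((norm x)\<^sup>2 * (norm z)\<^sup>2)"
      using Cauchy_Schwarz_ineq[of x z] by (simp add: b_def power2_norm_eq_inner power_mult_distrib)
    ultimately show ?thesis using assms by (intro mult_mono[OF mult_left_mono]) auto
  qed
  finally have 2: "\<bar>2 * q powr (- N) - (q + b) powr (- N) - (q - b) powr (- N)\<bar> \<le> 8 * N * (N + 1) * (norm x)\<^sup>2 * (a powr (- N - 1) * (norm z)\<^sup>2)"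
    by (simp add: algebra_simps)
  have "\<bar>?e\<bar> \<le> 2 * \<bar>p powr (- N) - q powr (- N)\<bar> + \<bar>2 * q powr (- N) - (q + b) powr (- N) - (q - b) powr (- N)\<bar>"
    unfolding e by (smt (verit))
  also have "\<dots> \<le> (2 * N + 8 * N * (N + 1) * (norm x)\<^sup>2) * (a powr (- N - 1) * (norm z)\<^sup>2)"
    using 1 2 by (simp add: algebra_simps)
  finally have "\<bar>?e\<bar> * t \<le> (2 * N + 8 * N * (N + 1) * (norm x)\<^sup>2) * (a powr (- N - 1) * (norm z)\<^sup>2) * t"
    using assms by (intro mult_right_mono) auto
  also have "\<dots> = (2 * N + 8 * N * (N + 1) * (norm x)\<^sup>2) * (a powr (- N - 1) * (t * (norm z)\<^sup>2))"
    by (simp add: mult_ac)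
  also have "\<dots> \<le> (2 * N + 8 * N * (N + 1) * (norm x)\<^sup>2) * (a powr (- N - 1) * a)"
    using a assms by (intro mult_left_mono) auto
  also have "a powr (- N - 1) * a = a powr (- N)" using a by (simp add: powr_mult_base mult.commute)
  finally show ?thesis
    unfolding a_def[symmetric] using triv assms by (intro decay_bound) auto
qed

section \<open>Joint integrability in t and z\<close>

lemma integrable_Beta_half_line:
  fixes a b :: real
  assumes "a > 0" "b > 0"
  shows "integrable lborel (\<lambda>t. indicator {0<..} t * (t powr (a - 1) * (1 + t) powr (- (a + b))))"
proof (rule integrableI_nn_integral_finite)
  have "(\<integral>\<^sup>+t. ennreal (indicator {0<..} t * (t powr (a - 1) * (1 + t) powr (- (a + b)))) \<partial>lborel)
    = (\<integral>\<^sup>+t. ennreal (t powr (a - 1) * (1 + 1 * t) powr (- (a + b))) * indicator {0<..} t \<partial>lborel)"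
    by (intro nn_integral_cong) (auto simp: indicator_def)
  also have "\<dots> = ennreal (1 powr (- b) * 1 powr (- a) * Beta a b)"
    using assms by (intro nn_integral_Beta_half_line) auto
  finally show "(\<integral>\<^sup>+t. ennreal (indicator {0<..} t * (t powr (a - 1) * (1 + t) powr (- (a + b)))) \<partial>lborel)
    = ennreal (1 powr (- b) * 1 powr (- a) * Beta a b)" .
qed auto

text \<open>Integrating the majorant over z yields a multiple of t^(-D/2), which leaves
  t^(\<alpha>/2 - 1) (1 + t)^(-\<gamma>) in t. This is integrable at 0 because \<alpha> > 0 and at
  infinity because \<gamma> > \<alpha>/2, so the decay rate \<gamma> decides which \<alpha> are
  covered.\<close>

lemma integrable_weighted:
  fixes E :: "real \<Rightarrow> 'a::euclidean_space \<Rightarrow> real"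
  defines "D \<equiv> real DIM('a)"
  assumes [measurable]: "case_prod E \<in> borel_measurable (lborel \<Otimes>\<^sub>M lborel)"
    and E: "\<And>t z. t > 0 \<Longrightarrow> \<bar>E t z\<bar> \<le> C * (1 + t * (norm z)\<^sup>2) powr (- D) * (1 + t) powr (- \<gamma>)"
    and "\<alpha> > 0" "\<gamma> > \<alpha> / 2"
  shows "integrable (lborel \<Otimes>\<^sub>M lborel) (\<lambda>(t, z). indicator {0<..} t * t powr ((D + \<alpha>) / 2 - 1) * E t z)"
proof -
  define w where "w t = indicator {0<..} t * t powr ((D + \<alpha>) / 2 - 1)" for t :: real
  have w0: "w t \<ge> 0" "t \<le> 0 \<Longrightarrow> w t = 0" for t by (auto simp: w_def)
  have [measurable]: "w \<in> borel_measurable borel" unfolding w_def by measurable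
  define g where "g = (\<lambda>(t, z :: 'a). w t * (C * (1 + t * (norm z)\<^sup>2) powr (- D) * (1 + t) powr (- \<gamma>)))"
  define V where "V = D * unit_ball_vol D * Beta (D / 2 + 1) (D / 2)"
  have I: "has_bochner_integral lborel (\<lambda>z :: 'a. (1 + t * (norm z)\<^sup>2) powr (- D)) (V * t powr (- D / 2))"
    if "t > 0" for t
    using has_bochner_integral_powr_norm[of 1 t "0 :: 'a"] that unfolding V_def D_def by simp
  have "integrable (lborel \<Otimes>\<^sub>M lborel) g"
  proof (rule lborel_pair.Fubini_integrable)
    show "g \<in> borel_measurable (lborel \<Otimes>\<^sub>M lborel)" unfolding g_def by measurable
    show "AE t in lborel. integrable lborel (\<lambda>z. g (t, z))"
    proof (rule AE_I2)
      fix t :: real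
      show "integrable lborel (\<lambda>z. g (t, z))"
      proof (cases "t > 0")
        case True
        thus ?thesis using I[OF True] unfolding g_def
          by (auto simp: has_bochner_integral_iff intro!: integrable_mult_right integrable_mult_left)
      qed (simp add: g_def w0)
    qed
    have "(\<integral>z. norm (g (t, z)) \<partial>lborel) = \<bar>C\<bar> * V * (indicator {0<..} t * (t powr (\<alpha> / 2 - 1) * (1 + t) powr (- (\<alpha> / 2 + (\<gamma> - \<alpha> / 2)))))" for t
    proof (cases "t > 0")
      case True
      have "(\<integral>z. norm (g (t, z)) \<partial>lborel) = (\<integral>z. (w t * \<bar>C\<bar> * (1 + t) powr (- \<gamma>)) * (1 + t * (norm z)\<^sup>2) powr (- D) \<partial>(lborel :: 'a measure))"
        using True w0 by (intro Bochner_Integration.integral_cong) (auto simp: g_def abs_mult)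
      also have "\<dots> = (w t * \<bar>C\<bar> * (1 + t) powr (- \<gamma>)) * (V * t powr (- D / 2))"
        using I[OF True] by (simp add: has_bochner_integral_iff)
      also have "\<dots> = \<bar>C\<bar> * V * ((t powr ((D + \<alpha>) / 2 - 1) * t powr (- D / 2)) * (1 + t) powr (- \<gamma>))"
        using True by (simp add: w_def)
      also have "t powr ((D + \<alpha>) / 2 - 1) * t powr (- D / 2) = t powr (\<alpha> / 2 - 1)"
      proof -
        have "(D + \<alpha>) / 2 - 1 + - D / 2 = \<alpha> / 2 - 1" by argo
        thus ?thesis by (metis powr_add)
      qed
      finally show ?thesis using True by simp
    qed (simp add: g_def w0)
    moreover have "integrable lborel (\<lambda>t. \<bar>C\<bar> * V * (indicator {0<..} t * (t powr (\<alpha> / 2 - 1) * (1 + t) powr (- (\<alpha> / 2 + (\<gamma> - \<alpha> / 2))))))"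
      using assms by (intro integrable_mult_right integrable_Beta_half_line) auto
    ultimately show "integrable lborel (\<lambda>t. \<integral>z. norm (g (t, z)) \<partial>lborel)" by simp
  qed
  hence "integrable (lborel \<Otimes>\<^sub>M lborel) (\<lambda>(t, z). w t * E t z)"
  proof (rule Bochner_Integration.integrable_bound)
    show "AE p in lborel \<Otimes>\<^sub>M lborel. norm (case p of (t, z) \<Rightarrow> w t * E t z) \<le> norm (g p)"
    proof (rule AE_I2, clarify)
      fix t :: real and z :: 'a
      show "norm (w t * E t z) \<le> norm (g (t, z))"
      proof (cases "t > 0")
        case True
        have "norm (w t * E t z) \<le> w t * (C * (1 + t * (norm z)\<^sup>2) powr (- D) * (1 + t) powr (- \<gamma>))"
          using E[OF True, of z] w0[of t] by (simp add: abs_mult mult_left_mono)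
        also have "\<dots> \<le> norm (g (t, z))" by (simp add: g_def)
        finally show ?thesis .
      qed (simp add: g_def w0)
    qed
  qed measurable
  thus ?thesis by (simp add: w_def)
qed

section \<open>Translation, reflection and symmetrization of integrals\<close>

lemma lborel_integral_translate:
  fixes f :: "'a::euclidean_space \<Rightarrow> real"
  assumes [measurable]: "f \<in> borel_measurable borel"
  shows "integrable lborel (\<lambda>y. f (y - x)) \<longleftrightarrow> integrable lborel f"
    and "(\<integral>y. f (y - x) \<partial>lborel) = (\<integral>z. f z \<partial>lborel)"
proof -
  have *: "integrable (distr lborel borel ((+) x)) (\<lambda>y. f (y - x)) \<longleftrightarrow> integrable lborel (\<lambda>z. f (x + z - x))"
    by (rule integrable_distr_eq) measurable
  have **: "(\<integral>y. f (y - x) \<partial>distr lborel borel ((+) x)) = (\<integral>z. f (x + z - x) \<partial>lborel)"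
    by (rule integral_distr) measurable
  show "integrable lborel (\<lambda>y. f (y - x)) \<longleftrightarrow> integrable lborel f"
    using * by (simp add: lborel_distr_plus)
  show "(\<integral>y. f (y - x) \<partial>lborel) = (\<integral>z. f z \<partial>lborel)"
    using ** by (simp add: lborel_distr_plus)
qed

lemma lborel_integral_reflect:
  fixes f :: "'a::euclidean_space \<Rightarrow> real"
  assumes [measurable]: "f \<in> borel_measurable borel"
  shows "integrable lborel (\<lambda>y. f (- y)) \<longleftrightarrow> integrable lborel f"
    and "(\<integral>y. f (- y) \<partial>lborel) = (\<integral>z. f z \<partial>lborel)"
proof -
  have d: "distr lborel borel uminus = (lborel :: 'a measure)"
    by (subst lborel_affine[of "-1" 0]) (auto simp: density_1 one_ennreal_def[symmetric])
  have *: "integrable (distr lborel borel uminus) f \<longleftrightarrow> integrable lborel (\<lambda>z. f (- z))"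
    by (rule integrable_distr_eq) measurable
  have **: "(\<integral>y. f y \<partial>distr lborel borel uminus) = (\<integral>z. f (- z) \<partial>lborel)"
    by (rule integral_distr) measurable
  show "integrable lborel (\<lambda>y. f (- y)) \<longleftrightarrow> integrable lborel f"
    using * by (simp add: d)
  show "(\<integral>y. f (- y) \<partial>lborel) = (\<integral>z. f z \<partial>lborel)"
    using ** by (simp add: d)
qed

lemma integral_symmetrize:
  fixes f :: "'a::euclidean_space \<Rightarrow> real"
  assumes "integrable lborel f"
  shows "(\<integral>z. f z \<partial>lborel) = (\<integral>z. f z + f (- z) \<partial>lborel) / 2"
proof -
  have [measurable]: "f \<in> borel_measurable borel" using assms by simp
  have "(\<integral>z. f z + f (- z) \<partial>lborel) = (\<integral>z. f z \<partial>lborel) + (\<integral>z. f (- z) \<partial>lborel)"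
    using assms lborel_integral_reflect(1)[of f] by (intro Bochner_Integration.integral_add) auto
  thus ?thesis using lborel_integral_reflect(2)[of f] by simp
qed

section \<open>The difference quotient of \<open>Phi\<close> as an integral over t\<close>

text \<open>The power difference formula with A = 1 + |x|^2, B = 1 + |x + z|^2, r = |z|^2 and N = D.
  The choice of \<beta> makes \<beta> - D the exponent of \<open>Phi\<close> and r^(-\<beta>) the
  kernel; \<alpha> \<noteq> D means \<beta> \<noteq> N. At z = 0 both sides vanish.\<close>

lemma has_bochner_integral_Phi_difference:
  fixes x z :: "'a::euclidean_space"
  defines "D \<equiv> real DIM('a)"
  assumes "\<alpha> > 0" "\<alpha> < 2" "\<alpha> \<noteq> D"
  defines "\<beta> \<equiv> (D + \<alpha>) / 2"
  shows "has_bochner_integral lborel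
    (\<lambda>t. indicator {0<..} t * t powr (\<beta> - 1) *
      ((1 + (norm x)\<^sup>2 + t * (norm z)\<^sup>2) powr (- D) - (1 + (norm (x + z))\<^sup>2 + t * (norm z)\<^sup>2) powr (- D)))
    (D * Beta \<beta> (D + 1 - \<beta>) / (D - \<beta>) * ((Phi \<alpha> x - Phi \<alpha> (x + z)) / norm z powr (D + \<alpha>)))"
proof (cases "z = 0")
  case False
  have D: "D \<ge> 1" by (simp add: D_def Suc_le_eq)
  have "has_bochner_integral lborel
    (\<lambda>t. indicator {0<..} t * t powr (\<beta> - 1) *
      (((1 + (norm x)\<^sup>2) + (norm z)\<^sup>2 * t) powr (- D) - ((1 + (norm (x + z))\<^sup>2) + (norm z)\<^sup>2 * t) powr (- D)))
    (D * Beta \<beta> (D + 1 - \<beta>) / (D - \<beta>) * ((norm z)\<^sup>2) powr (- \<beta>) * ((1 + (norm x)\<^sup>2) powr (\<beta> - D) - (1 + (norm (x + z))\<^sup>2) powr (\<beta> - D)))"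
    using False assms D by (intro has_bochner_integral_powr_difference) (auto simp: \<beta>_def field_simps add_pos_nonneg)
  moreover have "Phi \<alpha> y = (1 + (norm y)\<^sup>2) powr (\<beta> - D)" for y :: 'a
  proof -
    have "(\<alpha> - D) / 2 = \<beta> - D" unfolding \<beta>_def by argo
    thus ?thesis unfolding Phi_def D_def by metis
  qed
  moreover have "((norm z)\<^sup>2) powr (- \<beta>) = 1 / norm z powr (D + \<alpha>)"
  proof -
    have "((norm z)\<^sup>2) powr (- \<beta>) = norm z powr (- (D + \<alpha>))"
    proof -
      have "2 * (- \<beta>) = - (D + \<alpha>)" unfolding \<beta>_def by argo
      thus ?thesis using False powr_powr[of "norm z" 2 "- \<beta>"] by simp
    qed
    thus ?thesis by (simp only: powr_minus_divide)
  qed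
  ultimately show ?thesis by (simp add: mult_ac)
qed (simp add: has_bochner_integral_zero)

text \<open>The integrand of the fractional Laplacian in the increment z = y - x, so that the
  singularity sits at 0 and symmetrization is z -> -z.\<close>

definition Phi_quotient :: "real \<Rightarrow> 'a::euclidean_space \<Rightarrow> 'a \<Rightarrow> real" where
  "Phi_quotient \<alpha> x z = (Phi \<alpha> x - Phi \<alpha> (x + z)) / norm z powr (real DIM('a) + \<alpha>)"

lemma borel_measurable_Phi_quotient [measurable]: "Phi_quotient \<alpha> x \<in> borel_measurable borel"
  unfolding Phi_quotient_def Phi_def by measurable

lemma Beta_real_pos: "a > 0 \<Longrightarrow> b > 0 \<Longrightarrow> Beta a b > (0 :: real)"
  by (simp add: Beta_def Gamma_real_pos)

text \<open>\<kappa> is negative when \<alpha> > D; being nonzero is enough to divide it out of the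
  identities below. The last identity adds the representations for z and -z.\<close>

lemma Phi_quotient_eq_integral:
  fixes x z :: "'a::euclidean_space"
  defines "D \<equiv> real DIM('a)"
  assumes "\<alpha> > 0" "\<alpha> < 2" "\<alpha> \<noteq> D"
  defines "\<beta> \<equiv> (D + \<alpha>) / 2"
  defines "\<kappa> \<equiv> D * Beta \<beta> (D + 1 - \<beta>) / (D - \<beta>)"
  shows "\<kappa> \<noteq> 0"
    and "(\<integral>t. indicator {0<..} t * t powr (\<beta> - 1) *
      ((1 + (norm x)\<^sup>2 + t * (norm z)\<^sup>2) powr (- D) - (1 + (norm (x + z))\<^sup>2 + t * (norm z)\<^sup>2) powr (- D)) \<partial>lborel)
      = \<kappa> * Phi_quotient \<alpha> x z" (is "?I = _")
    and "(\<integral>t. indicator {0<..} t * t powr (\<beta> - 1) *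
      (2 * (1 + (norm x)\<^sup>2 + t * (norm z)\<^sup>2) powr (- D) - (1 + (norm (x + z))\<^sup>2 + t * (norm z)\<^sup>2) powr (- D)
        - (1 + (norm (x - z))\<^sup>2 + t * (norm z)\<^sup>2) powr (- D)) \<partial>lborel)
      = \<kappa> * (Phi_quotient \<alpha> x z + Phi_quotient \<alpha> x (- z))" (is "?J = _")
proof -
  have D: "D \<ge> 1" by (simp add: D_def Suc_le_eq)
  have "Beta \<beta> (D + 1 - \<beta>) > 0" using D assms by (intro Beta_real_pos) (auto simp: \<beta>_def field_simps)
  moreover have "D - \<beta> \<noteq> 0" using \<open>\<alpha> \<noteq> D\<close> by (simp add: \<beta>_def field_simps)
  ultimately show "\<kappa> \<noteq> 0" using D by (simp add: \<kappa>_def)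
  have I: "has_bochner_integral lborel (\<lambda>t. indicator {0<..} t * t powr (\<beta> - 1) *
      ((1 + (norm x)\<^sup>2 + t * (norm z)\<^sup>2) powr (- D) - (1 + (norm (x + z))\<^sup>2 + t * (norm z)\<^sup>2) powr (- D)))
      (\<kappa> * Phi_quotient \<alpha> x z)" for z
    using has_bochner_integral_Phi_difference[of \<alpha> x z] assms by (simp add: Phi_quotient_def)
  show "?I = \<kappa> * Phi_quotient \<alpha> x z" using I[of z] by (simp add: has_bochner_integral_iff)
  have "?J = (\<integral>t. indicator {0<..} t * t powr (\<beta> - 1) *
      ((1 + (norm x)\<^sup>2 + t * (norm z)\<^sup>2) powr (- D) - (1 + (norm (x + z))\<^sup>2 + t * (norm z)\<^sup>2) powr (- D))
     + indicator {0<..} t * t powr (\<beta> - 1) *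
      ((1 + (norm x)\<^sup>2 + t * (norm (- z))\<^sup>2) powr (- D) - (1 + (norm (x + - z))\<^sup>2 + t * (norm (- z))\<^sup>2) powr (- D)) \<partial>lborel)"
    by (intro Bochner_Integration.integral_cong) (auto simp: algebra_simps)
  also have "\<dots> = \<kappa> * Phi_quotient \<alpha> x z + \<kappa> * Phi_quotient \<alpha> x (- z)"
    using has_bochner_integral_add[OF I[of z] I[of "- z"]] by (simp only: has_bochner_integral_iff)
  finally show "?J = \<kappa> * (Phi_quotient \<alpha> x z + Phi_quotient \<alpha> x (- z))" by (simp only: distrib_left)
qed

text \<open>By Fubini, integrability in (t, z) passes to the t-integral, which is \<kappa> times the
  quotient. The first difference decays with \<gamma> = 1/2, which exceeds \<alpha>/2 exactly for
  \<alpha> < 1; away from z = 0 it decays with \<gamma> = 1, which covers all \<alpha> < 2.\<close>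

lemma integrable_Phi_quotient:
  fixes x :: "'a::euclidean_space"
  assumes "\<alpha> > 0" "\<alpha> < 2" "\<alpha> \<noteq> real DIM('a)"
  shows "\<alpha> < 1 \<Longrightarrow> integrable lborel (Phi_quotient \<alpha> x)"
    and "\<delta> > 0 \<Longrightarrow> integrable lborel (\<lambda>z. indicator {z. norm z > \<delta>} z * Phi_quotient \<alpha> x z)"
proof -
  define D where "D = real DIM('a)"
  define \<beta> where "\<beta> = (D + \<alpha>) / 2"
  define \<kappa> where "\<kappa> = D * Beta \<beta> (D + 1 - \<beta>) / (D - \<beta>)"
  define E where "E t z = (1 + (norm x)\<^sup>2 + t * (norm z)\<^sup>2) powr (- D) - (1 + (norm (x + z))\<^sup>2 + t * (norm z)\<^sup>2) powr (- D)" for t z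
  have [measurable]: "case_prod E \<in> borel_measurable (lborel \<Otimes>\<^sub>M lborel)" unfolding E_def by measurable
  have D: "D > 0" by (simp add: D_def)
  have \<kappa>: "\<kappa> \<noteq> 0" "(\<integral>t. indicator {0<..} t * t powr (\<beta> - 1) * E t z \<partial>lborel) = \<kappa> * Phi_quotient \<alpha> x z" for z
    unfolding E_def \<kappa>_def \<beta>_def D_def using Phi_quotient_eq_integral[of \<alpha>, where ?'a = 'a] assms by blast+
  {
    assume \<alpha>: "\<alpha> < 1"
    have "integrable (lborel \<Otimes>\<^sub>M lborel) (\<lambda>(t, z). indicator {0<..} t * t powr (\<beta> - 1) * E t z)"
      unfolding \<beta>_def D_def
    proof (rule integrable_weighted[where \<gamma> = "1 / 2"])
      show "\<bar>E t z\<bar> \<le> 2 * (1 + D * (2 * norm x + 1)) * (1 + t * (norm z)\<^sup>2) powr (- real DIM('a)) * (1 + t) powr (- (1 / 2))"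
        if "t > 0" for t z
        unfolding E_def using first_difference_decay(1)[OF that D] by (simp add: D_def)
    qed (use \<alpha> assms in auto)
    from lborel_pair.integrable_snd[OF this] have "integrable lborel (\<lambda>z. \<kappa> * Phi_quotient \<alpha> x z)"
      by (simp only: \<kappa>(2))
    thus "integrable lborel (Phi_quotient \<alpha> x)" using \<kappa>(1) by simp
  }
  assume \<delta>: "\<delta> > 0"
  have "integrable (lborel \<Otimes>\<^sub>M lborel) (\<lambda>(t, z). indicator {0<..} t * t powr (\<beta> - 1) * (indicator {z. norm z > \<delta>} z * E t z))"
    unfolding \<beta>_def D_def
  proof (rule integrable_weighted[where \<gamma> = 1])
    show "\<bar>indicator {z. norm z > \<delta>} z * E t z\<bar> \<le> 2 * (1 + D * (2 * norm x / \<delta> + 1)) * (1 + t * (norm z)\<^sup>2) powr (- real DIM('a)) * (1 + t) powr (- 1)"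
      if "t > 0" for t z
    proof (cases "norm z > \<delta>")
      case True
      thus ?thesis unfolding E_def using first_difference_decay(2)[OF that D \<delta> True] by (simp add: D_def)
    next
      case False
      thus ?thesis using \<delta> D by simp
    qed
  qed (use assms in auto)
  from lborel_pair.integrable_snd[OF this]
  have "integrable lborel (\<lambda>z. indicator {z. norm z > \<delta>} z * (\<integral>t. indicator {0<..} t * t powr (\<beta> - 1) * E t z \<partial>lborel))"
    by (simp add: mult.left_commute)
  hence "integrable lborel (\<lambda>z. \<kappa> * (indicator {z. norm z > \<delta>} z * Phi_quotient \<alpha> x z))"
    by (simp only: \<kappa>(2) mult.left_commute)
  thus "integrable lborel (\<lambda>z. indicator {z. norm z > \<delta>} z * Phi_quotient \<alpha> x z)" using \<kappa>(1) by simp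
qed

text \<open>The second difference decays with \<gamma> = 1 > \<alpha>/2, so Fubini applies without
  truncation. Integrating over z first leaves a one-dimensional power difference in A t, whose
  scaling in A produces A^(-\<beta>).\<close>

lemma has_bochner_integral_Phi_quotient_sym:
  fixes x :: "'a::euclidean_space"
  defines "D \<equiv> real DIM('a)"
  assumes "\<alpha> > 0" "\<alpha> < 2" "\<alpha> \<noteq> D"
  defines "\<beta> \<equiv> (D + \<alpha>) / 2"
  shows "has_bochner_integral lborel (\<lambda>z. Phi_quotient \<alpha> x z + Phi_quotient \<alpha> x (- z))
    (2 * (D * unit_ball_vol D * Beta (D / 2 + 1) (D / 2) * (D / \<alpha> * Beta \<beta> (1 - \<alpha> / 2))
     / (D * Beta \<beta> (D + 1 - \<beta>) / (D - \<beta>))) * (1 + (norm x)\<^sup>2) powr (- \<beta>))"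
proof -
  define \<kappa> where "\<kappa> = D * Beta \<beta> (D + 1 - \<beta>) / (D - \<beta>)"
  define V where "V = D * unit_ball_vol D * Beta (D / 2 + 1) (D / 2)"
  define A where "A = 1 + (norm x)\<^sup>2"
  define w where "w t = indicator {0<..} t * t powr (\<beta> - 1)" for t :: real
  define E where "E t z = 2 * (1 + (norm x)\<^sup>2 + t * (norm z)\<^sup>2) powr (- D) - (1 + (norm (x + z))\<^sup>2 + t * (norm z)\<^sup>2) powr (- D)
    - (1 + (norm (x - z))\<^sup>2 + t * (norm z)\<^sup>2) powr (- D)" for t z
  have [measurable]: "case_prod E \<in> borel_measurable (lborel \<Otimes>\<^sub>M lborel)" unfolding E_def by measurable
  have D: "D > 0" by (simp add: D_def)
  have A: "A > 0" by (simp add: A_def add_pos_nonneg)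
  have \<kappa>: "\<kappa> \<noteq> 0" "(\<integral>t. w t * E t z \<partial>lborel) = \<kappa> * (Phi_quotient \<alpha> x z + Phi_quotient \<alpha> x (- z))" for z
    unfolding E_def w_def \<kappa>_def \<beta>_def D_def using Phi_quotient_eq_integral[of \<alpha>, where ?'a = 'a] assms by blast+
  have int: "integrable (lborel \<Otimes>\<^sub>M lborel) (\<lambda>(t, z). w t * E t z)"
    unfolding w_def \<beta>_def D_def
  proof (rule integrable_weighted[where \<gamma> = 1])
    show "\<bar>E t z\<bar> \<le> 2 * (2 + (2 * D + 8 * D * (D + 1) * (norm x)\<^sup>2)) * (1 + t * (norm z)\<^sup>2) powr (- real DIM('a)) * (1 + t) powr (- 1)"
      if "t > 0" for t z
      unfolding E_def using second_difference_decay[OF that D, of x z] by (simp add: D_def)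
  qed (use assms in auto)
  have "integrable lborel (\<lambda>z. \<kappa> * (Phi_quotient \<alpha> x z + Phi_quotient \<alpha> x (- z)))"
    using lborel_pair.integrable_snd[OF int] by (simp only: \<kappa>(2))
  hence int': "integrable lborel (\<lambda>z. Phi_quotient \<alpha> x z + Phi_quotient \<alpha> x (- z))" using \<kappa>(1) by simp
  \<comment> \<open>The summand 0 is kept so that the result has the shape of the power difference
    formula with endpoints 0 and 1.\<close>
  have inner: "(\<integral>z. w t * E t z \<partial>lborel) = 2 * V * (w t * ((0 + A * t) powr (- (D / 2)) - (1 + A * t) powr (- (D / 2))))" for t
  proof (cases "t > 0")
    case True
    have 1: "has_bochner_integral lborel (\<lambda>z :: 'a. 2 * (1 + (norm x)\<^sup>2 + t * (norm z)\<^sup>2) powr (- D)) (2 * (V * (A * t) powr (- D / 2)))"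
      using has_bochner_integral_powr_norm[of A t "0 :: 'a"] True A
      unfolding V_def D_def A_def by (intro has_bochner_integral_mult_right) simp
    have 2: "has_bochner_integral lborel (\<lambda>z. (1 + (norm (x + z))\<^sup>2 + t * (norm z)\<^sup>2) powr (- D)) (V * (1 + A * t) powr (- D / 2))"
      using has_bochner_integral_powr_norm_shift[OF True, of x] unfolding V_def D_def A_def .
    have 3: "has_bochner_integral lborel (\<lambda>z. (1 + (norm (x - z))\<^sup>2 + t * (norm z)\<^sup>2) powr (- D)) (V * (1 + A * t) powr (- D / 2))"
      using has_bochner_integral_powr_norm_shift[OF True, of "- x"] norm_minus_commute[of x] unfolding V_def D_def A_def
      by simp
    have "(\<integral>z. E t z \<partial>lborel) = 2 * (V * (A * t) powr (- D / 2)) - V * (1 + A * t) powr (- D / 2) - V * (1 + A * t) powr (- D / 2)"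
      using has_bochner_integral_diff[OF has_bochner_integral_diff[OF 1 2] 3] unfolding E_def by (simp only: has_bochner_integral_iff)
    hence E: "(\<integral>z. E t z \<partial>lborel) = 2 * V * ((0 + A * t) powr (- (D / 2)) - (1 + A * t) powr (- (D / 2)))"
      by (simp add: algebra_simps)
    have "(\<integral>z. w t * E t z \<partial>lborel) = w t * (\<integral>z. E t z \<partial>lborel)" by simp
    thus ?thesis unfolding E by (simp only: mult.left_commute)
  qed (simp add: w_def)
  have "\<kappa> * (\<integral>z. Phi_quotient \<alpha> x z + Phi_quotient \<alpha> x (- z) \<partial>lborel) = (\<integral>z. (\<integral>t. w t * E t z \<partial>lborel) \<partial>lborel)"
    by (simp only: \<kappa>(2) integral_mult_right_zero)
  also have "\<dots> = (\<integral>t. (\<integral>z. w t * E t z \<partial>lborel) \<partial>lborel)"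
    by (rule lborel_pair.Fubini_integral[OF int])
  also have "\<dots> = 2 * V * (\<integral>t. w t * ((0 + A * t) powr (- (D / 2)) - (1 + A * t) powr (- (D / 2))) \<partial>lborel)"
    unfolding inner by (rule integral_mult_right_zero)
  \<comment> \<open>Here N = D/2, so \<beta> - N = \<alpha>/2 > 0 and the endpoint 0 is
    admissible.\<close>
  also have "(\<integral>t. w t * ((0 + A * t) powr (- (D / 2)) - (1 + A * t) powr (- (D / 2))) \<partial>lborel)
    = D / 2 * Beta \<beta> (D / 2 + 1 - \<beta>) / (D / 2 - \<beta>) * A powr (- \<beta>) * (0 powr (\<beta> - D / 2) - 1 powr (\<beta> - D / 2))"
    using has_bochner_integral_powr_difference[of 0 1 A "D / 2" \<beta>] D A assms unfolding w_def
    by (simp only: has_bochner_integral_iff) (simp add: \<beta>_def field_simps)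
  \<comment> \<open>The last bracket is 0 - 1 = -1, which cancels the sign of D/2 - \<beta> =
    -\<alpha>/2.\<close>
  also have "\<dots> = D / \<alpha> * Beta \<beta> (1 - \<alpha> / 2) * A powr (- \<beta>)"
  proof -
    have "D / 2 + 1 - \<beta> = 1 - \<alpha> / 2" "D / 2 - \<beta> = - (\<alpha> / 2)" by (simp_all add: \<beta>_def field_simps)
    note e = this
    show ?thesis unfolding e using \<open>\<alpha> > 0\<close> by simp
  qed
  finally have "\<kappa> * (\<integral>z. Phi_quotient \<alpha> x z + Phi_quotient \<alpha> x (- z) \<partial>lborel)
    = \<kappa> * (2 * (V * (D / \<alpha> * Beta \<beta> (1 - \<alpha> / 2)) / \<kappa>) * A powr (- \<beta>))"
    using \<kappa>(1) by simp
  hence "(\<integral>z. Phi_quotient \<alpha> x z + Phi_quotient \<alpha> x (- z) \<partial>lborel)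
    = 2 * (V * (D / \<alpha> * Beta \<beta> (1 - \<alpha> / 2)) / \<kappa>) * A powr (- \<beta>)"
    using mult_left_cancel[OF \<kappa>(1)] by blast
  thus ?thesis using int' by (simp add: has_bochner_integral_iff V_def A_def \<kappa>_def)
qed

section \<open>Evaluation of the constant\<close>

text \<open>With s = (D - \<alpha>)/2, the factor D - \<beta> = s cancels against Gamma (s + 1) = s
  Gamma s. The ball volume cancels the power of pi, and Gamma (1 - \<alpha>/2) cancels |Gamma
  (-\<alpha>/2)| up to \<alpha>/2. Since s is nonzero and above -1, it is not a pole of Gamma,
  although it may be negative.\<close>

lemma constant_eq_mu:
  assumes "d \<ge> 1" "\<alpha> > 0" "\<alpha> < 2" "\<alpha> \<noteq> real d"
  defines "D \<equiv> real d"
  defines "\<beta> \<equiv> (D + \<alpha>) / 2"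
  shows "frac_lap_const d \<alpha> * (D * unit_ball_vol D * Beta (D / 2 + 1) (D / 2) * (D / \<alpha> * Beta \<beta> (1 - \<alpha> / 2))
     / (D * Beta \<beta> (D + 1 - \<beta>) / (D - \<beta>))) = mu d \<alpha>"
proof -
  have D: "D \<ge> 1" using assms by simp
  have \<beta>: "\<beta> > 0" using D assms by (simp add: \<beta>_def)
  define s where "s = D - \<beta>"
  have s: "s \<noteq> 0" "s > - 1" "s \<notin> \<int>\<^sub>\<le>\<^sub>0" "s = (D - \<alpha>) / 2"
  proof -
    show eq: "s = (D - \<alpha>) / 2" by (simp add: s_def \<beta>_def field_simps)
    show s: "s \<noteq> 0" "s > - 1" unfolding eq using D assms by (auto simp: field_simps)
    show "s \<notin> \<int>\<^sub>\<le>\<^sub>0"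
    proof
      assume "s \<in> \<int>\<^sub>\<le>\<^sub>0"
      then obtain n where "s = real_of_int n" "n \<le> 0" by (auto elim: nonpos_Ints_cases)
      thus False using s by simp
    qed
  qed
  have G1: "Gamma (s + 1) = s * Gamma s" by (rule Gamma_plus1[OF s(3)])
  have G2: "Gamma (1 - \<alpha> / 2) = \<alpha> / 2 * \<bar>Gamma (- \<alpha> / 2)\<bar>"
  proof -
    have "- \<alpha> / 2 \<notin> \<int>\<^sub>\<le>\<^sub>0"
    proof
      assume "- \<alpha> / 2 \<in> \<int>\<^sub>\<le>\<^sub>0"
      then obtain n where n: "- \<alpha> / 2 = real_of_int n" by (auto elim: nonpos_Ints_cases)
      have "real_of_int n < 0" "real_of_int n > - 1" using assms(2,3) unfolding n[symmetric] by auto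
      thus False using of_int_less_iff[of "- 1" n, where 'a = real] by simp
    qed
    hence "Gamma (- \<alpha> / 2 + 1) = - \<alpha> / 2 * Gamma (- \<alpha> / 2)" by (rule Gamma_plus1)
    hence e: "Gamma (1 - \<alpha> / 2) = - \<alpha> / 2 * Gamma (- \<alpha> / 2)" by (simp add: add.commute)
    have "Gamma (1 - \<alpha> / 2) > 0" using assms by (intro Gamma_real_pos) auto
    \<comment> \<open>The sign resolves the absolute value in the normalizing constant.\<close>
    hence "Gamma (- \<alpha> / 2) < 0" unfolding e using assms(2) by (auto simp: zero_less_mult_iff mult_less_0_iff)
    thus ?thesis unfolding e by simp
  qed
  have G3: "Gamma (D / 2 + 1) = D / 2 * Gamma (D / 2)"
    using D by (intro Gamma_plus1) (auto elim!: nonpos_Ints_cases)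
  have pos: "Gamma (D / 2) > 0" "Gamma \<beta> > 0" "Gamma (D + 1) > 0" "Gamma (1 - \<alpha> / 2) > 0"
    using D \<beta> assms by (auto intro!: Gamma_real_pos)
  hence nz: "Gamma (D / 2) \<noteq> 0" "Gamma \<beta> \<noteq> 0" "Gamma (D + 1) \<noteq> 0" by linarith+
  have "Gamma s \<noteq> 0" using s(3) unfolding Gamma_eq_zero_iff .
  have B1: "Beta (D / 2 + 1) (D / 2) = Gamma (D / 2 + 1) * Gamma (D / 2) / Gamma (D + 1)"
    by (simp add: Beta_def add_ac)
  have B2: "Beta \<beta> (1 - \<alpha> / 2) = Gamma \<beta> * Gamma (1 - \<alpha> / 2) / Gamma (D / 2 + 1)"
  proof -
    have "\<beta> + (1 - \<alpha> / 2) = D / 2 + 1" unfolding \<beta>_def by argo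
    thus ?thesis unfolding Beta_def by metis
  qed
  have B3: "Beta \<beta> (D + 1 - \<beta>) = Gamma \<beta> * (s * Gamma s) / Gamma (D + 1)"
  proof -
    have "D + 1 - \<beta> = s + 1" "\<beta> + (D + 1 - \<beta>) = D + 1" by (simp_all add: s_def)
    thus ?thesis unfolding Beta_def G1[symmetric] by metis
  qed
  have fl: "frac_lap_const d \<alpha> = 2 powr \<alpha> * Gamma \<beta> / (pi powr (D / 2) * \<bar>Gamma (- \<alpha> / 2)\<bar>)"
    by (simp add: frac_lap_const_def \<beta>_def D_def add.commute)
  have m: "mu d \<alpha> = 2 powr \<alpha> * Gamma \<beta> / Gamma s"
    by (simp add: mu_def \<beta>_def D_def s(4))
  have v: "unit_ball_vol D = pi powr (D / 2) / Gamma (D / 2 + 1)" by (simp add: unit_ball_vol_def)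
  have "\<bar>Gamma (- \<alpha> / 2)\<bar> \<noteq> 0" using pos(4) unfolding G2 by auto
  thus ?thesis
    unfolding fl m v B1 B2 B3 s_def[symmetric] G2 G3
    using nz \<open>Gamma s \<noteq> 0\<close> s(1) D assms(2) by (simp add: divide_simps)
qed

section \<open>Evaluation of the fractional Laplacian\<close>

theorem theorem2p3:
  fixes \<alpha> :: real and x :: "'a::euclidean_space"
  assumes "0 < \<alpha>" and "\<alpha> < 2"
    and "real DIM('a) - \<alpha> > 0 \<or> \<not> (\<exists>k::int. real DIM('a) - \<alpha> = 2 * of_int k)"
  shows "frac_lap_exists \<alpha> (Phi \<alpha> :: 'a \<Rightarrow> real) x \<and>
         frac_lap \<alpha> (Phi \<alpha>) x = mu DIM('a) \<alpha> * Phi (- \<alpha>) x"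
proof -
  let ?F = "Phi_quotient \<alpha> x"
  let ?S = "\<lambda>z. ?F z + ?F (- z)"
  \<comment> \<open>L is the value of the integral in both regimes: the Lebesgue integral for
    \<alpha> < 1 and the principal value for \<alpha> \<ge> 1.\<close>
  define L where "L = (\<integral>z. ?S z \<partial>lborel) / 2"
  \<comment> \<open>If \<alpha> were the dimension, the difference would be 0, which is not positive
    and is even with k = 0.\<close>
  have ne: "\<alpha> \<noteq> real DIM('a)" using assms(3) by (auto dest: spec[of _ 0])
  define K where "K = DIM('a) * unit_ball_vol (real DIM('a)) * Beta (DIM('a) / 2 + 1) (DIM('a) / 2) *
      (DIM('a) / \<alpha> * Beta ((DIM('a) + \<alpha>) / 2) (1 - \<alpha> / 2))
    / (DIM('a) * Beta ((DIM('a) + \<alpha>) / 2) (real DIM('a) + 1 - (DIM('a) + \<alpha>) / 2) / (DIM('a) - (DIM('a) + \<alpha>) / 2))"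
  have S: "has_bochner_integral lborel ?S (2 * K * (1 + (norm x)\<^sup>2) powr (- ((DIM('a) + \<alpha>) / 2)))"
    unfolding K_def by (rule has_bochner_integral_Phi_quotient_sym[OF assms(1,2) ne])
  hence intS: "integrable lborel ?S" by (simp add: has_bochner_integral_iff)
  have "(- \<alpha> - DIM('a)) / 2 = - ((DIM('a) + \<alpha>) / 2)" by argo
  hence "Phi (- \<alpha>) x = (1 + (norm x)\<^sup>2) powr (- ((DIM('a) + \<alpha>) / 2))" unfolding Phi_def by metis
  with S have L: "L = K * Phi (- \<alpha>) x" by (simp add: L_def has_bochner_integral_iff)
  have K: "frac_lap_const DIM('a) \<alpha> * K = mu DIM('a) \<alpha>"
    unfolding K_def using assms ne by (intro constant_eq_mu) (auto simp: Suc_le_eq)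
  have lap_eq: "frac_lap_const DIM('a) \<alpha> * L = mu DIM('a) \<alpha> * Phi (- \<alpha>) x"
    unfolding L K[symmetric] by (rule mult.assoc[symmetric])
  have F: "frac_lap_integrand \<alpha> (Phi \<alpha>) x = (\<lambda>y. ?F (y - x))"
    by (auto simp: frac_lap_integrand_def Phi_quotient_def norm_minus_commute)
  show ?thesis
  proof (cases "\<alpha> < 1")
    case True
    have int: "integrable lborel ?F" using integrable_Phi_quotient(1)[OF assms(1,2) ne True] .
    hence "frac_lap_exists \<alpha> (Phi \<alpha>) x"
      unfolding frac_lap_exists_def F using True by (simp add: lborel_integral_translate)
    moreover have "(LINT y|lborel. frac_lap_integrand \<alpha> (Phi \<alpha>) x y) = L"
      unfolding F L_def using integral_symmetrize[OF int] by (simp add: lborel_integral_translate)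
    ultimately show ?thesis using True lap_eq by (simp add: frac_lap_def)
  next
    case False
    define I where "I \<delta> = (LINT y:{y. norm (x - y) > \<delta>}|lborel. frac_lap_integrand \<alpha> (Phi \<alpha>) x y)" for \<delta>
    let ?G = "\<lambda>\<delta> z. indicator {z. norm z > \<delta>} z * ?F z"
    have G: "indicator {y. norm (x - y) > \<delta>} y *\<^sub>R frac_lap_integrand \<alpha> (Phi \<alpha>) x y = ?G \<delta> (y - x)" for \<delta> y
      by (simp add: F indicator_def norm_minus_commute)
    have int: "integrable lborel (?G \<delta>)" if "\<delta> > 0" for \<delta>
      using integrable_Phi_quotient(2)[OF assms(1,2) ne that] .
    have tr: "integrable lborel (\<lambda>y. ?G \<delta> (y - x)) \<longleftrightarrow> integrable lborel (?G \<delta>)"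
      "(\<integral>y. ?G \<delta> (y - x) \<partial>lborel) = (\<integral>z. ?G \<delta> z \<partial>lborel)" for \<delta>
      by (rule lborel_integral_translate; measurable)+
    \<comment> \<open>The truncated region is invariant under z -> -z, so the truncated integral can
      be symmetrized too.\<close>
    have I: "I \<delta> = (\<integral>z. indicator {z. norm z > \<delta>} z * ?S z \<partial>lborel) / 2" if "\<delta> > 0" for \<delta>
    proof -
      have "I \<delta> = (\<integral>z. ?G \<delta> z \<partial>lborel)"
        unfolding I_def set_lebesgue_integral_def G tr ..
      also have "\<dots> = (\<integral>z. ?G \<delta> z + ?G \<delta> (- z) \<partial>lborel) / 2"
        by (rule integral_symmetrize[OF int[OF that]])
      also have "(\<integral>z. ?G \<delta> z + ?G \<delta> (- z) \<partial>lborel) = (\<integral>z. indicator {z. norm z > \<delta>} z * ?S z \<partial>lborel)"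
        by (intro Bochner_Integration.integral_cong) (auto simp: indicator_def)
      finally show ?thesis .
    qed
    have lim: "(I \<longlongrightarrow> L) (at_right 0)"
    \<comment> \<open>Passing to sequences makes dominated convergence available; the majorant is
      the symmetrized quotient itself, which is integrable without truncation.\<close>
    proof (rule tendsto_at_right_sequentially[of _ 1])
      fix S :: "nat \<Rightarrow> real"
      assume S: "\<And>n. 0 < S n" "S \<longlonglongrightarrow> 0"
      have "(\<lambda>n. \<integral>z. indicator {z. norm z > S n} z * ?S z \<partial>lborel) \<longlonglongrightarrow> (\<integral>z. ?S z \<partial>lborel)"
      proof (rule integral_dominated_convergence[where w = "\<lambda>z. norm (?S z)"])
        show "AE z in lborel. (\<lambda>n. indicator {z. norm z > S n} z * ?S z) \<longlonglongrightarrow> ?S z"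
        proof (rule AE_I2)
          fix z :: 'a
          show "(\<lambda>n. indicator {z. norm z > S n} z * ?S z) \<longlonglongrightarrow> ?S z"
          \<comment> \<open>For z \<noteq> 0 the indicator is eventually 1. At z = 0 it is always 0,
            but the symmetrized quotient vanishes there as well.\<close>
          proof (cases "z = 0")
            case False
            hence "eventually (\<lambda>n. S n < norm z) sequentially" using order_tendstoD(2)[OF S(2), of "norm z"] by simp
            hence "eventually (\<lambda>n. indicator {z. norm z > S n} z * ?S z = ?S z) sequentially"
              by eventually_elim simp
            thus ?thesis by (rule tendsto_eventually)
          qed (simp add: Phi_quotient_def)
        qed
      qed (use intS in \<open>auto simp: indicator_def\<close>)
      hence "(\<lambda>n. (\<integral>z. indicator {z. norm z > S n} z * ?S z \<partial>lborel) / 2) \<longlonglongrightarrow> L"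
        unfolding L_def by (intro tendsto_divide tendsto_const) auto
      thus "(\<lambda>n. I (S n)) \<longlonglongrightarrow> L" using S(1) by (simp add: I)
    qed auto
    have "set_integrable lborel {y. norm (x - y) > \<delta>} (frac_lap_integrand \<alpha> (Phi \<alpha>) x)" if "\<delta> > 0" for \<delta>
      unfolding set_integrable_def G tr(1) by (rule int[OF that])
    hence "frac_lap_exists \<alpha> (Phi \<alpha>) x"
      unfolding frac_lap_exists_def using False lim unfolding I_def[abs_def] by auto
    moreover have "Lim (at_right 0) I = L" by (rule tendsto_Lim[OF _ lim]) simp
    ultimately show ?thesis using False lap_eq unfolding I_def[abs_def] by (simp add: frac_lap_def)
  qed
qed

end
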